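(* Fix $a\in(0,\tfrac12)$ and $\gamma\in(-\sqrt{2a(1-2a)},0)$. There exist $\lambda\in[-1-a,-1+a]$ and $E\in(0,1)$ such that, for these parameters, the $\Theta$-flow has a saddles connector and the $\Omega$-flow has a saddles connector (both as described in the context).
   Context: $\Theta$-flow: on $[0,\pi]\times\mathbb R$ ($\Theta$ mod $2\pi$ on the cylinder), $$\dot\theta=\sin\theta,\qquad \dot\Theta=-2a\sin\theta\cos\theta\cos\Theta+2aE\sin^2\theta\sin\Theta-\sin\Theta+2\lambda\sin\theta;$$ its saddles connector is an orbit in $(0,\pi)\times\mathbb R$ with $\alpha$-limit $(0,0)$ and $\omega$-limit $(\pi,-\pi)$. $\Omega$-flow: on $[-\tfrac\pi2,\tfrac\pi2]\times\mathbb R$ ($\Omega$ mod $2\pi$ on the cylinder), $$\dot\xi=\cos^2\xi,\qquad \dot\Omega=2a\sin\xi\cos\Omega+2\lambda\cos\xi\sin\Omega+2\gamma\sin\xi\cos\xi+\cos^2\xi-2aE;$$ with $\arccos$ the principal branch in $[0,\pi]$, its saddles connector is an orbit in the open strip with $\alpha$-limit $(-\tfrac\pi2,-\pi+\arccos E)$ and $\omega$-limit $(\tfrac\pi2,-\arccos E)$. (These are the angular and radial Prüfer equations of the separated Dirac equation on the zero-gravity Kerr–Newman spacetime with $\kappa=\tfrac12$, units $m=1$, $\gamma=-eQ$; a common pair $(E,\lambda)$ with both connectors yields a square-integrable bound state of energy $E$.) *)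

theory Defs
  imports Complex_Main
begin

definition Theta_rhs :: "real \<Rightarrow> real \<Rightarrow> real \<Rightarrow> real \<Rightarrow> real \<Rightarrow> real" where
  "Theta_rhs a E lam th Th =
     - 2 * a * sin th * cos th * cos Th + 2 * a * E * (sin th)\<^sup>2 * sin Th - sin Th + 2 * lam * sin th"

definition Omega_rhs :: "real \<Rightarrow> real \<Rightarrow> real \<Rightarrow> real \<Rightarrow> real \<Rightarrow> real \<Rightarrow> real" where
  "Omega_rhs a gam E lam xi Om =
     2 * a * sin xi * cos Om + 2 * lam * cos xi * sin Om + 2 * gam * sin xi * cos xi
     + (cos xi)\<^sup>2 - 2 * a * E"

definition Theta_saddles_connector :: "real \<Rightarrow> real \<Rightarrow> real \<Rightarrow> bool" where
  "Theta_saddles_connector a E lam \<longleftrightarrow>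
     (\<exists>th Th :: real \<Rightarrow> real.
        (\<forall>t. 0 < th t \<and> th t < pi) \<and>
        (\<forall>t. (th has_real_derivative sin (th t)) (at t)) \<and>
        (\<forall>t. (Th has_real_derivative Theta_rhs a E lam (th t) (Th t)) (at t)) \<and>
        (th \<longlongrightarrow> 0) at_bot \<and> (Th \<longlongrightarrow> 0) at_bot \<and>
        (th \<longlongrightarrow> pi) at_top \<and> (Th \<longlongrightarrow> - pi) at_top)"

definition Omega_saddles_connector :: "real \<Rightarrow> real \<Rightarrow> real \<Rightarrow> real \<Rightarrow> bool" where
  "Omega_saddles_connector a gam E lam \<longleftrightarrow>
     (\<exists>xi Om :: real \<Rightarrow> real.
        (\<forall>t. - (pi / 2) < xi t \<and> xi t < pi / 2) \<and>
        (\<forall>t. (xi has_real_derivative (cos (xi t))\<^sup>2) (at t)) \<and>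
        (\<forall>t. (Om has_real_derivative Omega_rhs a gam E lam (xi t) (Om t)) (at t)) \<and>
        (xi \<longlongrightarrow> - (pi / 2)) at_bot \<and> (Om \<longlongrightarrow> - pi + arccos E) at_bot \<and>
        (xi \<longlongrightarrow> pi / 2) at_top \<and> (Om \<longlongrightarrow> - arccos E) at_top)"

end

theory Submission
  imports Defs "HOL-Analysis.Analysis"
begin

text \<open>
  Along an orbit \<open>\<theta> = 2 arctan e\<^sup>t\<close> and \<open>\<xi> = arctan t\<close>, so both flows become scalar non-autonomous
  equations with bounded, globally Lipschitz right-hand sides. Put \<open>E = sin h\<close>; then the two
  saddles of the \<open>\<Omega>\<close>-flow sit at \<open>-\<pi>/2 - h\<close> and \<open>-\<pi>/2 + h\<close>. On \<open>[-N, N]\<close> impose boundary values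
  close to the saddles on both equations. The mismatches at \<open>N\<close> have opposite signs
  on opposite sides of a rectangle of parameters \<open>(\<lambda>, h)\<close>: for \<open>\<lambda> = -1\<close> and \<open>\<lambda> = -1 + a\<close> the curve
  \<open>\<Theta> = -\<theta>\<close> is a super- and a subsolution; for \<open>h = (1 - 2a)/2\<close> the curve
  \<open>-\<pi>/2 + h sin \<xi>\<close> is a subsolution; and for \<open>h\<close> close to \<open>\<pi>/2\<close> the attractive Coulomb term
  \<open>2\<gamma>/t\<close>, which is not integrable at infinity, drives \<open>\<Omega>\<close> below \<open>-\<pi>\<close>. By the Poincare-Miranda
  theorem both boundary value problems are solvable for a common \<open>(\<lambda>, h)\<close>. Barriers which do not
  depend on \<open>N\<close> confine the solutions near the saddles, so that a limit \<open>N \<rightarrow> \<infinity>\<close>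
  along a subsequence yields the connectors. The right ends reduce to the left ones by the
  reflection \<open>t \<mapsto> -t\<close>, \<open>x \<mapsto> -\<pi> - x\<close>, which leaves the first equation invariant and changes the
  sign of \<open>\<gamma>\<close> in the second.
\<close>

section \<open>Scalar differential equations\<close>

lemma antiderivative_real:
  fixes g :: "real \<Rightarrow> real"
  assumes "continuous_on UNIV g"
  shows "\<exists>G. G 0 = 0 \<and> (\<forall>t. (G has_real_derivative g t) (at t))"
proof -
  have "\<exists>F. \<forall>x::real. -\<infinity> < ereal x \<longrightarrow> ereal x < \<infinity> \<longrightarrow> (F has_vector_derivative g x) (at x)"
    by (rule einterval_antiderivative)
      (use assms in \<open>auto simp: continuous_on_eq_continuous_at\<close>)
  then obtain F where F: "\<And>x. (F has_real_derivative g x) (at x)"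
    by (auto simp: has_real_derivative_iff_has_vector_derivative)
  have "((\<lambda>t. F t - F 0) has_real_derivative g t) (at t)" for t
    using F by (auto intro!: derivative_eq_intros)
  then show ?thesis by (intro exI[of _ "\<lambda>t. F t - F 0"]) auto
qed

text \<open>The right-hand side is the primitive of \<open>d * exp (K * t)\<close> vanishing at 0,
  so both its sum and its difference with \<open>G\<close> are nondecreasing on [0, t].\<close>

lemma exp_growth_bound_nonneg:
  fixes G g :: "real \<Rightarrow> real"
  assumes G: "\<And>t. (G has_real_derivative g t) (at t)" and G0: "G 0 = 0"
    and g: "\<And>t. \<bar>g t\<bar> \<le> d * exp (K * \<bar>t\<bar>)" and K: "K > 0" and t: "t \<ge> 0"
  shows "\<bar>G t\<bar> \<le> d * (exp (K * t) - 1) / K"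
proof -
  let ?e = "\<lambda>t. d * (exp (K * t) - 1) / K"
  have 1: "?e 0 - G 0 \<le> ?e t - G t"
  proof (rule DERIV_nonneg_imp_nondecreasing[OF t])
    fix x assume x: "0 \<le> x" "x \<le> t"
    have "((\<lambda>t. ?e t - G t) has_real_derivative (d * exp (K * x) - g x)) (at x)"
      using K by (auto intro!: derivative_eq_intros G)
    moreover have "d * exp (K * x) - g x \<ge> 0" using g[of x] x by auto
    ultimately show "\<exists>y. ((\<lambda>t. ?e t - G t) has_real_derivative y) (at x) \<and> 0 \<le> y" by blast
  qed
  have 2: "?e 0 + G 0 \<le> ?e t + G t"
  proof (rule DERIV_nonneg_imp_nondecreasing[OF t])
    fix x assume x: "0 \<le> x" "x \<le> t"
    have "((\<lambda>t. ?e t + G t) has_real_derivative (d * exp (K * x) + g x)) (at x)"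
      using K by (auto intro!: derivative_eq_intros G)
    moreover have "d * exp (K * x) + g x \<ge> 0" using g[of x] x by auto
    ultimately show "\<exists>y. ((\<lambda>t. ?e t + G t) has_real_derivative y) (at x) \<and> 0 \<le> y" by blast
  qed
  show ?thesis using 1 2 G0 by auto
qed

lemma exp_growth_bound:
  fixes G g :: "real \<Rightarrow> real"
  assumes G: "\<And>t. (G has_real_derivative g t) (at t)" and G0: "G 0 = 0"
    and g: "\<And>t. \<bar>g t\<bar> \<le> d * exp (K * \<bar>t\<bar>)" and K: "K > 0"
  shows "\<bar>G t\<bar> \<le> d * (exp (K * \<bar>t\<bar>) - 1) / K"
proof (cases "t \<ge> 0")
  case True
  then show ?thesis using exp_growth_bound_nonneg[OF assms True] by simp
next
  case False
  have "((\<lambda>t. G (- t)) has_real_derivative - g (- t)) (at t)" for t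
    using G[of "- t"] by (simp add: DERIV_mirror)
  from exp_growth_bound_nonneg[OF this, of d K "-t"] show ?thesis
    using False G0 g[of "- _"] K by auto
qed

definition solves :: "(real \<Rightarrow> real \<Rightarrow> real) \<Rightarrow> (real \<Rightarrow> real) \<Rightarrow> bool" where
  "solves f y \<longleftrightarrow> (\<forall>t. (y has_real_derivative f t (y t)) (at t))"

text \<open>The unknown is the slope of the solution damped by
  \<open>exp (- K * \<bar>t\<bar>)\<close>, a bounded continuous function because \<open>f\<close>
  is bounded. In this weighted norm the Picard map contracts on the whole line at once, so no local
  solutions have to be glued.\<close>

lemma picard_at_zero:
  fixes f :: "real \<Rightarrow> real \<Rightarrow> real"
  assumes L: "L > 0" and lip: "\<And>t x y. \<bar>f t x - f t y\<bar> \<le> L * \<bar>x - y\<bar>"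
    and bd: "\<And>t x. \<bar>f t x\<bar> \<le> M"
    and cont: "\<And>y. continuous_on UNIV y \<Longrightarrow> continuous_on UNIV (\<lambda>t. f t (y t))"
  shows "\<exists>y. y 0 = y0 \<and> solves f y"
proof -
  \<comment> \<open>Integrating the weight \<open>exp (K * \<bar>t\<bar>)\<close> gains a factor
    1/\<open>K\<close>, so the contraction constant is \<open>L\<close> / \<open>K\<close> =
    1/2.\<close>
  define K where "K = 2 * L"
  have K: "K > 0" using L by (simp add: K_def)
  \<comment> \<open>An antiderivative normalised at 0 stands in for the integral and treats both
    directions of time alike; \<open>I z\<close> undoes the damping and recovers the solution up to
    \<open>y0\<close>.\<close>
  define P where "P z G \<longleftrightarrow> G 0 = 0 \<and> (\<forall>t. (G has_real_derivative exp (K * \<bar>t\<bar>) * apply_bcontfun z t) (at t))"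
    for z :: "real \<Rightarrow>\<^sub>C real" and G :: "real \<Rightarrow> real"
  define I where "I z = (SOME G. P z G)" for z
  have I: "P z (I z)" for z
  proof -
    have "continuous_on UNIV (\<lambda>t. exp (K * \<bar>t\<bar>) * apply_bcontfun z t)"
      by (intro continuous_intros) auto
    from antiderivative_real[OF this] have "\<exists>G. P z G" by (auto simp: P_def)
    then show ?thesis unfolding I_def by (rule someI_ex)
  qed
  have contI: "continuous_on UNIV (\<lambda>t. y0 + I z t)" for z
    using I[of z] unfolding P_def
    by (intro continuous_intros DERIV_continuous_on[where D="\<lambda>t. exp (K * \<bar>t\<bar>) * apply_bcontfun z t"])
       (auto intro: has_field_derivative_at_within)
  define V where "V z t = exp (- K * \<bar>t\<bar>) * f t (y0 + I z t)" for z t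
  have V: "V z \<in> bcontfun" for z
  proof (rule bcontfun_normI[of _ M])
    show "continuous_on UNIV (V z)" unfolding V_def
      by (intro continuous_intros cont contI)
    show "norm (V z x) \<le> M" for x
    proof -
      have "exp (- K * \<bar>x\<bar>) * \<bar>f x (y0 + I z x)\<bar> \<le> 1 * M"
        using K bd[of x] by (intro mult_mono) (auto simp: zero_le_mult_iff)
      then show ?thesis by (simp add: V_def abs_mult)
    qed
  qed
  define T where "T z = Bcontfun (V z)" for z
  have T: "apply_bcontfun (T z) t = V z t" for z t
    by (simp add: T_def Bcontfun_inverse V)
  have contr: "dist (T z) (T w) \<le> 1/2 * dist z w" for z w
  proof (rule dist_bound)
    fix t
    have D: "((\<lambda>t. I z t - I w t) has_real_derivative
        exp (K * \<bar>t\<bar>) * (apply_bcontfun z t - apply_bcontfun w t)) (at t)" for t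
      using I[of z] I[of w] unfolding P_def
      by (auto intro!: derivative_eq_intros simp: algebra_simps)
    have "\<bar>exp (K * \<bar>t\<bar>) * (apply_bcontfun z t - apply_bcontfun w t)\<bar> \<le> dist z w * exp (K * \<bar>t\<bar>)" for t
      using dist_bounded[of z t w] by (simp add: abs_mult dist_real_def mult.commute)
    from exp_growth_bound[OF D _ this K, of t]
    have "\<bar>I z t - I w t\<bar> \<le> dist z w * (exp (K * \<bar>t\<bar>) - 1) / K"
      using I[of z] I[of w] unfolding P_def by auto
    also have "\<dots> \<le> dist z w * exp (K * \<bar>t\<bar>) / K"
      using K by (intro divide_right_mono mult_left_mono) auto
    finally have *: "\<bar>I z t - I w t\<bar> \<le> dist z w * exp (K * \<bar>t\<bar>) / K" .
    have "dist (T z t) (T w t) = exp (- K * \<bar>t\<bar>) * \<bar>f t (y0 + I z t) - f t (y0 + I w t)\<bar>"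
      by (simp add: T V_def dist_real_def abs_mult flip: right_diff_distrib)
    also have "\<dots> \<le> exp (- K * \<bar>t\<bar>) * (L * \<bar>I z t - I w t\<bar>)"
      using lip[of t "y0 + I z t" "y0 + I w t"] by (intro mult_left_mono) auto
    also have "\<dots> \<le> exp (- K * \<bar>t\<bar>) * (L * (dist z w * exp (K * \<bar>t\<bar>) / K))"
      using L by (intro mult_left_mono *) auto
    also have "\<dots> = 1/2 * dist z w" using L by (simp add: K_def exp_minus field_simps)
    finally show "dist (T z t) (T w t) \<le> 1/2 * dist z w" .
  qed
  have "\<exists>!z. T z = z"
    by (rule banach_fix_type[of "1/2"]) (use contr in auto)
  then obtain z where z: "T z = z" by blast
  have "((\<lambda>t. y0 + I z t) has_real_derivative f t (y0 + I z t)) (at t)" for t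
  proof -
    have "exp (K * \<bar>t\<bar>) * apply_bcontfun z t = f t (y0 + I z t)"
      using T[of z t] unfolding z by (simp add: V_def exp_minus)
    with I[of z] show ?thesis unfolding P_def
      by (auto intro!: derivative_eq_intros)
  qed
  then show ?thesis using I[of z] unfolding P_def solves_def
    by (intro exI[of _ "\<lambda>t. y0 + I z t"]) auto
qed

lemma picard:
  fixes f :: "real \<Rightarrow> real \<Rightarrow> real"
  assumes L: "L > 0" and lip: "\<And>t x y. \<bar>f t x - f t y\<bar> \<le> L * \<bar>x - y\<bar>"
    and bd: "\<And>t x. \<bar>f t x\<bar> \<le> M"
    and cont: "\<And>y. continuous_on UNIV y \<Longrightarrow> continuous_on UNIV (\<lambda>t. f t (y t))"
  shows "\<exists>y. y t0 = y0 \<and> solves f y"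
proof -
  have "\<exists>y. y 0 = y0 \<and> solves (\<lambda>t. f (t + t0)) y"
  proof (rule picard_at_zero[OF L])
    fix y :: "real \<Rightarrow> real" assume y: "continuous_on UNIV y"
    have "continuous_on UNIV (\<lambda>t. y (t - t0))"
      by (rule continuous_on_compose2[OF y]) (auto intro!: continuous_intros)
    from cont[OF this] have *: "continuous_on UNIV (\<lambda>t. f t (y (t - t0)))" .
    have "continuous_on UNIV (\<lambda>t. (\<lambda>t. f t (y (t - t0))) (t + t0))"
      by (rule continuous_on_compose2[OF *]) (auto intro!: continuous_intros)
    then show "continuous_on UNIV (\<lambda>t. f (t + t0) (y t))" by simp
  qed (use lip bd in auto)
  then obtain y where y0: "y 0 = y0"
    and y: "\<And>t. (y has_real_derivative f (t + t0) (y t)) (at t)" by (auto simp: solves_def)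
  have "((\<lambda>t. y (t - t0)) has_real_derivative f t (y (t - t0))) (at t)" for t
    using y[of "t - t0"] DERIV_shift[of y _ t "- t0"] by simp
  then show ?thesis using y0 by (intro exI[of _ "\<lambda>t. y (t - t0)"]) (auto simp: solves_def)
qed

section \<open>Gronwall estimate and continuous dependence\<close>

text \<open>Squares keep the distance differentiable. With d = \<open>y\<close> - \<open>z\<close>,
  the bound 2|d|e <= d^2 + e^2 gives (d^2 + e^2)' <= (2L + 1)(d^2 + e^2); the summand e^2 absorbs
  the difference of the two fields.\<close>

lemma gronwall_square_forward:
  fixes f g :: "real \<Rightarrow> real \<Rightarrow> real"
  assumes y: "solves f y" and z: "solves g z"
    and lip: "\<And>t x y. \<bar>f t x - f t y\<bar> \<le> L * \<bar>x - y\<bar>"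
    and e: "\<And>t x. \<bar>f t x - g t x\<bar> \<le> e" and t: "t0 \<le> t"
  shows "(y t - z t)\<^sup>2 \<le> exp ((2 * L + 1) * (t - t0)) * ((y t0 - z t0)\<^sup>2 + e\<^sup>2)"
proof -
  define K where "K = 2 * L + 1"
  define h where "h t = exp (- K * t) * ((y t - z t)\<^sup>2 + e\<^sup>2)" for t
  have "h t \<le> h t0"
  proof (rule DERIV_nonpos_imp_nonincreasing[OF t])
    fix x
    let ?d = "y x - z x" and ?r = "f x (y x) - g x (z x)"
    have "(h has_real_derivative exp (- K * x) * (2 * ?d * ?r - K * (?d\<^sup>2 + e\<^sup>2))) (at x)"
      unfolding h_def using y z unfolding solves_def
      by (auto intro!: derivative_eq_intros simp: algebra_simps power2_eq_square)
    moreover have "2 * ?d * ?r - K * (?d\<^sup>2 + e\<^sup>2) \<le> 0"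
    proof -
      have e0: "0 \<le> e" using e[of 0 0] by linarith
      have L0: "0 \<le> L" using lip[of 0 1 0] by simp
      have "\<bar>?r\<bar> \<le> L * \<bar>?d\<bar> + e" using lip[of x "y x" "z x"] e[of x "z x"] by linarith
      then have "\<bar>?d\<bar> * \<bar>?r\<bar> \<le> \<bar>?d\<bar> * (L * \<bar>?d\<bar> + e)" by (intro mult_left_mono) auto
      moreover have "\<bar>?d\<bar> * (L * \<bar>?d\<bar> + e) = L * ?d\<^sup>2 + \<bar>?d\<bar> * e"
        by (simp add: algebra_simps power2_eq_square flip: abs_mult)
      ultimately have "?d * ?r \<le> L * ?d\<^sup>2 + \<bar>?d\<bar> * e"
        using abs_ge_self[of "?d * ?r"] unfolding abs_mult by linarith
      moreover have "2 * (\<bar>?d\<bar> * e) \<le> ?d\<^sup>2 + e\<^sup>2"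
        using sum_squares_bound[of "\<bar>?d\<bar>" e] by simp
      moreover have "0 \<le> L * e\<^sup>2" using L0 by simp
      ultimately show ?thesis by (simp add: K_def algebra_simps)
    qed
    ultimately show "\<exists>y. (h has_real_derivative y) (at x) \<and> y \<le> 0"
      by (meson exp_ge_zero mult_nonneg_nonpos)
  qed
  then have "exp (K * t) * h t \<le> exp (K * t) * h t0" by (intro mult_left_mono) auto
  moreover have "exp (K * t) * h s = exp (K * (t - s)) * ((y s - z s)\<^sup>2 + e\<^sup>2)" for s
  proof -
    have "exp (K * t) * exp (- K * s) = exp (K * (t - s))"
      by (simp add: algebra_simps flip: exp_add)
    then show ?thesis unfolding h_def by (metis mult.assoc)
  qed
  ultimately have "(y t - z t)\<^sup>2 + e\<^sup>2 \<le> exp (K * (t - t0)) * ((y t0 - z t0)\<^sup>2 + e\<^sup>2)"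
    by simp
  then show ?thesis unfolding K_def using zero_le_power2[of e] by linarith
qed

text \<open>Reversing both time and space leaves the sign of the derivative unchanged. With
  \<open>c\<close> = 0 this yields the backward Gronwall estimate; with \<open>c\<close> = -pi it
  carries the right end of both flows to the left end.\<close>

lemma solves_reflect:
  assumes "solves f y"
  shows "solves (\<lambda>t x. f (- t) (c - x)) (\<lambda>t. c - y (- t))"
  unfolding solves_def
proof
  fix t
  have "((\<lambda>t. y (- t)) has_real_derivative - f (- t) (y (- t))) (at t)"
    using assms by (simp add: solves_def flip: DERIV_mirror)
  then show "((\<lambda>t. c - y (- t)) has_real_derivative f (- t) (c - (c - y (- t)))) (at t)"
    by (auto intro!: derivative_eq_intros)
qed

lemma gronwall_square:
  fixes f g :: "real \<Rightarrow> real \<Rightarrow> real"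
  assumes y: "solves f y" and z: "solves g z"
    and lip: "\<And>t x y. \<bar>f t x - f t y\<bar> \<le> L * \<bar>x - y\<bar>"
    and e: "\<And>t x. \<bar>f t x - g t x\<bar> \<le> e"
  shows "(y t - z t)\<^sup>2 \<le> exp ((2 * L + 1) * \<bar>t - t0\<bar>) * ((y t0 - z t0)\<^sup>2 + e\<^sup>2)"
proof (cases "t0 \<le> t")
  case True
  then show ?thesis using gronwall_square_forward[OF assms True] by simp
next
  case False
  have "\<bar>f (- t) (0 - x) - f (- t) (0 - y)\<bar> \<le> L * \<bar>x - y\<bar>" for t x y
    using lip[of "-t" "-x" "-y"] by (simp add: abs_minus_commute)
  from gronwall_square_forward[OF solves_reflect[OF y] solves_reflect[OF z] this e, of "-t0" "-t"]
  show ?thesis using False by (simp add: power2_commute)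
qed

text \<open>Stated for an arbitrary filter, so that it serves both for continuity of the end values
  in the parameters and for the limit along a subsequence of growing intervals.\<close>

lemma solves_tendsto:
  fixes f :: "'i \<Rightarrow> real \<Rightarrow> real \<Rightarrow> real"
  assumes z: "solves g z"
    and y: "eventually (\<lambda>i. solves (f i) (y i) \<and> (\<forall>t x. \<bar>g t x - f i t x\<bar> \<le> e i)) F"
    and lip: "\<And>t x y. \<bar>g t x - g t y\<bar> \<le> L * \<bar>x - y\<bar>"
    and e: "(e \<longlongrightarrow> 0) F" and y0: "((\<lambda>i. y i t0) \<longlongrightarrow> z t0) F"
  shows "((\<lambda>i. y i t) \<longlongrightarrow> z t) F"
proof -
  let ?B = "\<lambda>i. exp ((2 * L + 1) * \<bar>t - t0\<bar>) * ((z t0 - y i t0)\<^sup>2 + (e i)\<^sup>2)"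
  have "(?B \<longlongrightarrow> exp ((2 * L + 1) * \<bar>t - t0\<bar>) * ((z t0 - z t0)\<^sup>2 + 0\<^sup>2)) F"
    by (intro tendsto_intros e y0)
  then have B: "(?B \<longlongrightarrow> 0) F" by simp
  have "((\<lambda>i. (z t - y i t)\<^sup>2) \<longlongrightarrow> 0) F"
  proof (rule tendsto_sandwich[OF _ _ tendsto_const B])
    show "eventually (\<lambda>i. (z t - y i t)\<^sup>2 \<le> ?B i) F"
      using y by eventually_elim (use gronwall_square[OF z _ lip] in blast)
  qed auto
  then have "((\<lambda>i. sqrt ((z t - y i t)\<^sup>2)) \<longlongrightarrow> sqrt 0) F" by (rule tendsto_real_sqrt)
  then have "((\<lambda>i. \<bar>y i t - z t\<bar>) \<longlongrightarrow> 0) F" by (simp add: abs_minus_commute)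
  then show ?thesis using LIM_zero_cancel tendsto_rabs_zero_iff by blast
qed

section \<open>Comparison with sub- and supersolutions\<close>

text \<open>The Lipschitz condition makes a non-strict inequality sufficient. If \<open>w\<close> =
  \<open>y\<close> - \<open>b\<close> were negative at \<open>q\<close>, then after its last zero
  \<open>s\<close> it would satisfy \<open>w\<close> <= 0 and w' >= L w, so
  \<open>exp (- L * t) * w t\<close> would be nondecreasing from 0, a contradiction.\<close>

lemma subsolution_le:
  assumes y: "solves f y" and lip: "\<And>t x y. \<bar>f t x - f t y\<bar> \<le> L * \<bar>x - y\<bar>"
    and b: "\<And>t. p \<le> t \<Longrightarrow> t \<le> q \<Longrightarrow> \<exists>b'. (b has_real_derivative b') (at t) \<and> b' \<le> f t (b t)"
    and pq: "p \<le> q" and init: "b p \<le> y p"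
  shows "b q \<le> y q"
proof (rule ccontr)
  assume neg: "\<not> b q \<le> y q"
  define w where "w t = y t - b t" for t
  have wc: "continuous_on {p..q} w"
    unfolding w_def
  proof (intro continuous_intros)
    show "continuous_on {p..q} y" using y unfolding solves_def
      by (meson DERIV_isCont continuous_at_imp_continuous_on)
    show "continuous_on {p..q} b" using b
      by (meson DERIV_isCont continuous_at_imp_continuous_on atLeastAtMost_iff)
  qed
  define Z where "Z = {t \<in> {p..q}. w t = 0}"
  have "\<exists>x. p \<le> x \<and> x \<le> q \<and> w x = 0"
    by (rule IVT2') (use neg init pq wc in \<open>auto simp: w_def\<close>)
  then have Zne: "Z \<noteq> {}" by (auto simp: Z_def)
  have "closed Z" unfolding Z_def
    by (rule continuous_closed_preimage_constant[OF wc]) auto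
  then have "compact Z" unfolding Z_def
    by (metis (no_types, lifting) bounded_closed_interval bounded_subset compact_eq_bounded_closed
        mem_Collect_eq subsetI)
  then obtain s where s: "s \<in> Z" and smax: "\<And>t. t \<in> Z \<Longrightarrow> t \<le> s"
    using compact_attains_sup Zne by metis
  have ws: "w s = 0" "p \<le> s" "s \<le> q" using s by (auto simp: Z_def)
  have wneg: "w t \<le> 0" if "s \<le> t" "t \<le> q" for t
  proof (rule ccontr)
    assume "\<not> w t \<le> 0"
    then have "\<exists>x. t \<le> x \<and> x \<le> q \<and> w x = 0"
      by (intro IVT2') (use neg that ws in \<open>auto simp: w_def intro!: continuous_on_subset[OF wc, unfolded w_def]\<close>)
    then obtain x where x: "t \<le> x" "x \<le> q" "w x = 0" by blast
    then have "x \<in> Z" using that ws by (auto simp: Z_def)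
    with smax that x have "t = s" by force
    then show False using \<open>\<not> w t \<le> 0\<close> ws by simp
  qed
  define h where "h t = exp (- L * t) * w t" for t
  have "h s \<le> h q"
  proof (rule DERIV_nonneg_imp_nondecreasing[OF ws(3)])
    fix x assume x: "s \<le> x" "x \<le> q"
    obtain b' where b': "(b has_real_derivative b') (at x)" "b' \<le> f x (b x)"
      using b[of x] x ws by auto
    have "(h has_real_derivative exp (- L * x) * ((f x (y x) - b') - L * w x)) (at x)"
      unfolding h_def w_def using y b' unfolding solves_def
      by (auto intro!: derivative_eq_intros simp: algebra_simps)
    moreover have "f x (y x) - b' - L * w x \<ge> 0"
      using lip[of x "y x" "b x"] b' wneg[OF x] by (auto simp: w_def abs_if algebra_simps split: if_splits)
    ultimately show "\<exists>y. (h has_real_derivative y) (at x) \<and> 0 \<le> y"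
      by (meson exp_ge_zero mult_nonneg_nonneg)
  qed
  then show False using neg ws by (auto simp: h_def w_def mult_le_0_iff zero_le_mult_iff)
qed

lemma supersolution_ge:
  assumes y: "solves f y" and lip: "\<And>t x y. \<bar>f t x - f t y\<bar> \<le> L * \<bar>x - y\<bar>"
    and b: "\<And>t. p \<le> t \<Longrightarrow> t \<le> q \<Longrightarrow> \<exists>b'. (b has_real_derivative b') (at t) \<and> f t (b t) \<le> b'"
    and pq: "p \<le> q" and init: "y p \<le> b p"
  shows "y q \<le> b q"
proof -
  have y': "solves (\<lambda>t x. - f t (- x)) (\<lambda>t. - y t)"
    using y by (auto simp: solves_def intro!: derivative_eq_intros)
  have "- b q \<le> - y q"
  proof (rule subsolution_le[OF y', of L p q "\<lambda>t. - b t"])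
    show "\<bar>- f t (- x) - - f t (- y)\<bar> \<le> L * \<bar>x - y\<bar>" for t x y
      using lip[of t "-x" "-y"] by (simp add: abs_minus_commute)
    show "\<exists>b'. ((\<lambda>t. - b t) has_real_derivative b') (at t) \<and> b' \<le> - f t (- (- b t))"
      if "p \<le> t" "t \<le> q" for t
      using b[OF that] by (metis DERIV_minus minus_minus neg_le_iff_le)
  qed (use pq init in auto)
  then show ?thesis by simp
qed

section \<open>Common zeros of two functions on a rectangle\<close>

text \<open>Brouwer's theorem for the displacement by -(f, g), clamped back to the rectangle. In the
  interior a fixed point is a zero; on an edge, clamping permits only the sign opposite to the
  assumed one, so the component vanishes there too.\<close>

lemma poincare_miranda:
  fixes f g :: "real \<times> real \<Rightarrow> real"
  assumes ab: "a \<le> b" "c \<le> d"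
    and cont: "continuous_on ({a..b} \<times> {c..d}) f" "continuous_on ({a..b} \<times> {c..d}) g"
    and f: "\<And>y. y \<in> {c..d} \<Longrightarrow> f (a, y) \<le> 0" "\<And>y. y \<in> {c..d} \<Longrightarrow> 0 \<le> f (b, y)"
    and g: "\<And>x. x \<in> {a..b} \<Longrightarrow> g (x, c) \<le> 0" "\<And>x. x \<in> {a..b} \<Longrightarrow> 0 \<le> g (x, d)"
  shows "\<exists>p \<in> {a..b} \<times> {c..d}. f p = 0 \<and> g p = 0"
proof -
  let ?K = "{a..b} \<times> {c..d}"
  define H where "H p = (max a (min b (fst p - f p)), max c (min d (snd p - g p)))" for p
  obtain x y where p: "x \<in> {a..b}" "y \<in> {c..d}" "H (x, y) = (x, y)"
  proof (rule brouwer[of ?K H])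
    show "compact ?K" by (intro compact_Times compact_Icc)
    show "convex ?K" by (intro convex_Times) (auto intro: convex_real_interval)
    show "?K \<noteq> {}" using ab by auto
    show "continuous_on ?K H" unfolding H_def by (intro continuous_intros cont)
    show "H \<in> ?K \<rightarrow> ?K" using ab by (auto simp: H_def)
  qed (use that in force)
  have "max a (min b (x - f (x, y))) = x" "max c (min d (y - g (x, y))) = y"
    using p by (auto simp: H_def)
  then have "f (x, y) = 0" "g (x, y) = 0"
    using f[OF p(2)] g[OF p(1)] p(1,2) by (auto simp: max_def min_def split: if_splits)
  then show ?thesis using p by blast
qed

section \<open>The angular flow\<close>

text \<open>Common shape of both flows once the first coordinate is a known function of time;
  bounded coefficients make it bounded and globally Lipschitz, as \<open>picard\<close>
  demands.\<close>

definition trig_field :: "(real \<Rightarrow> real) \<Rightarrow> (real \<Rightarrow> real) \<Rightarrow> (real \<Rightarrow> real) \<Rightarrow> real \<Rightarrow> real \<Rightarrow> real" where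
  "trig_field u v w t x = u t * cos x + v t * sin x + w t"

lemma sin_lipschitz: "\<bar>sin x - sin y\<bar> \<le> \<bar>x - y\<bar>" for x y :: real
proof -
  have "\<bar>sin x - sin y\<bar> = 2 * \<bar>sin ((x - y) / 2)\<bar> * \<bar>cos ((x + y) / 2)\<bar>"
    by (simp add: sin_diff_sin abs_mult)
  also have "\<dots> \<le> 2 * \<bar>(x - y) / 2\<bar> * 1"
    by (intro mult_mono abs_sin_x_le_abs_x) auto
  finally show ?thesis by simp
qed

lemma cos_lipschitz: "\<bar>cos x - cos y\<bar> \<le> \<bar>x - y\<bar>" for x y :: real
  using sin_lipschitz[of "pi / 2 - x" "pi / 2 - y"] by (simp add: sin_diff)

lemma trig_field_lipschitz:
  assumes "\<And>t. \<bar>u t\<bar> \<le> 1" "\<And>t. \<bar>v t\<bar> \<le> 2"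
  shows "\<bar>trig_field u v w t x - trig_field u v w t y\<bar> \<le> 3 * \<bar>x - y\<bar>"
proof -
  have "\<bar>u t * (cos x - cos y)\<bar> \<le> 1 * \<bar>x - y\<bar>"
    unfolding abs_mult by (intro mult_mono assms cos_lipschitz) auto
  moreover have "\<bar>v t * (sin x - sin y)\<bar> \<le> 2 * \<bar>x - y\<bar>"
    unfolding abs_mult by (intro mult_mono assms sin_lipschitz) auto
  moreover have "trig_field u v w t x - trig_field u v w t y = u t * (cos x - cos y) + v t * (sin x - sin y)"
    by (simp add: trig_field_def algebra_simps)
  ultimately show ?thesis by linarith
qed

lemma trig_field_bound:
  assumes "\<And>t. \<bar>u t\<bar> \<le> 1" "\<And>t. \<bar>v t\<bar> \<le> 2" "\<And>t. \<bar>w t\<bar> \<le> 3"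
  shows "\<bar>trig_field u v w t x\<bar> \<le> 6"
proof -
  have "\<bar>u t * cos x\<bar> \<le> 1 * 1" "\<bar>v t * sin x\<bar> \<le> 2 * 1"
    unfolding abs_mult by (intro mult_mono assms; simp)+
  then show ?thesis using assms(3)[of t] by (simp add: trig_field_def)
qed

lemma trig_field_solution:
  assumes "\<And>t. \<bar>u t\<bar> \<le> 1" "\<And>t. \<bar>v t\<bar> \<le> 2" "\<And>t. \<bar>w t\<bar> \<le> 3"
    and "continuous_on UNIV u" "continuous_on UNIV v" "continuous_on UNIV w"
  shows "\<exists>y. y t0 = y0 \<and> solves (trig_field u v w) y"
proof (rule picard[where L = 3 and M = 6])
  show "continuous_on UNIV (\<lambda>t. trig_field u v w t (y t))" if "continuous_on UNIV y" for y
    unfolding trig_field_def by (intro continuous_intros that assms)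
qed (simp, rule trig_field_lipschitz[OF assms(1,2)], rule trig_field_bound[OF assms(1,2,3)])

section \<open>The polar angle as a function of time and the angular field along it\<close>

definition theta :: "real \<Rightarrow> real" where "theta t = 2 * arctan (exp t)"

lemma theta_bounds: "0 < theta t" "theta t < pi"
  using arctan_ubound[of "exp t"] by (auto simp: theta_def)

lemma sin_theta_pos: "0 < sin (theta t)"
  using theta_bounds sin_gt_zero by blast

lemma theta_has_derivative: "(theta has_real_derivative sin (theta t)) (at t)"
proof -
  have "sin (theta t) = 2 * exp t / (1 + (exp t)\<^sup>2)"
    by (simp add: theta_def sin_double sin_arctan cos_arctan power2_eq_square flip: real_sqrt_mult)
  then show ?thesis unfolding theta_def[abs_def]
    by (auto intro!: derivative_eq_intros simp: field_simps)
qed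

lemma theta_minus: "theta (- t) = pi - theta t"
  using arctan_inverse[of "exp t"] by (simp add: theta_def exp_minus inverse_eq_divide)

lemma continuous_theta [continuous_intros]: "continuous_on S theta"
  using theta_has_derivative DERIV_isCont by (blast intro: continuous_at_imp_continuous_on)

lemma theta_at_bot: "(theta \<longlongrightarrow> 0) at_bot"
proof -
  have "((\<lambda>t. 2 * arctan (exp t)) \<longlongrightarrow> 2 * arctan (0::real)) at_bot"
    by (intro tendsto_intros exp_at_bot)
  then show ?thesis by (simp add: theta_def[abs_def])
qed

lemma theta_at_top: "(theta \<longlongrightarrow> pi) at_top"
proof -
  have "((\<lambda>t. pi - theta (- t)) \<longlongrightarrow> pi - 0) at_top"
    by (intro tendsto_intros) (rule theta_at_bot[unfolded filterlim_at_bot_mirror])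
  then show ?thesis by (simp add: theta_minus)
qed

definition Theta_field :: "real \<Rightarrow> real \<Rightarrow> real \<Rightarrow> real \<Rightarrow> real \<Rightarrow> real" where
  "Theta_field a l h t x = Theta_rhs a (sin h) l (theta t) x"

lemma Theta_field_trig:
  "Theta_field a l h = trig_field (\<lambda>t. - (2 * a * sin (theta t) * cos (theta t)))
     (\<lambda>t. 2 * a * sin h * (sin (theta t))\<^sup>2 - 1) (\<lambda>t. 2 * l * sin (theta t))"
  by (intro ext) (simp add: Theta_field_def Theta_rhs_def trig_field_def algebra_simps)

lemma Theta_field_reflect: "Theta_field a l h (- t) (- pi - x) = Theta_field a l h t x"
  by (simp add: Theta_field_def Theta_rhs_def theta_minus sin_diff cos_diff)

lemma abs_mult_le_one: "\<bar>x\<bar> \<le> 1 \<Longrightarrow> \<bar>y\<bar> \<le> 1 \<Longrightarrow> \<bar>x * y\<bar> \<le> 1" for x y :: real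
  by (simp add: abs_mult mult_le_one)

lemma Theta_coeffs:
  assumes a: "0 < a" "a < 1 / 2" and l: "-1 \<le> l" "l \<le> -1 + a"
  shows "\<bar>- (2 * a * sin (theta t) * cos (theta t))\<bar> \<le> 1"
    "\<bar>2 * a * sin h * (sin (theta t))\<^sup>2 - 1\<bar> \<le> 2"
    "\<bar>2 * l * sin (theta t)\<bar> \<le> 3"
proof -
  have "\<bar>2 * a\<bar> \<le> 1" "\<bar>l\<bar> \<le> 1" using a l by auto
  note b = this abs_sin_le_one abs_cos_le_one abs_mult_le_one
  show "\<bar>- (2 * a * sin (theta t) * cos (theta t))\<bar> \<le> 1"
    unfolding abs_minus_cancel by (intro b)
  have "\<bar>2 * a * sin h * (sin (theta t))\<^sup>2\<bar> \<le> 1"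
    unfolding power2_eq_square by (intro b)
  then show "\<bar>2 * a * sin h * (sin (theta t))\<^sup>2 - 1\<bar> \<le> 2" by linarith
  have "\<bar>l * sin (theta t)\<bar> \<le> 1" by (intro b)
  then show "\<bar>2 * l * sin (theta t)\<bar> \<le> 3" by linarith
qed

lemma Theta_field_lipschitz:
  assumes "0 < a" "a < 1 / 2" "-1 \<le> l" "l \<le> -1 + a"
  shows "\<bar>Theta_field a l h t x - Theta_field a l h t y\<bar> \<le> 3 * \<bar>x - y\<bar>"
  unfolding Theta_field_trig by (intro trig_field_lipschitz Theta_coeffs[OF assms])

lemma Theta_field_solution:
  assumes "0 < a" "a < 1 / 2" "-1 \<le> l" "l \<le> -1 + a"
  shows "\<exists>y. y t0 = y0 \<and> solves (Theta_field a l h) y"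
  unfolding Theta_field_trig
  by (intro trig_field_solution Theta_coeffs[OF assms] continuous_intros)

text \<open>The bound is uniform in \<open>t\<close> and \<open>x\<close>, so it can serve as the
  field error \<open>e\<close> in the Gronwall estimate.\<close>

lemma Theta_field_param:
  assumes a: "0 < a" "a < 1 / 2"
  shows "\<bar>Theta_field a l h t x - Theta_field a l' h' t x\<bar> \<le> \<bar>h - h'\<bar> + 2 * \<bar>l - l'\<bar>"
proof -
  have a2: "\<bar>2 * a\<bar> \<le> 1" using a by auto
  have "\<bar>(2 * a) * (sin (theta t) * (sin (theta t) * sin x)) * (sin h - sin h')\<bar> \<le> 1 * \<bar>h - h'\<bar>"
    using a2
    unfolding abs_mult[of "(2 * a) * (sin (theta t) * (sin (theta t) * sin x))"]
    by (intro mult_mono sin_lipschitz abs_mult_le_one[of "2 * a"] abs_mult_le_one[of "sin _"] abs_sin_le_one) auto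
  moreover have "\<bar>(l - l') * sin (theta t)\<bar> \<le> \<bar>l - l'\<bar> * 1"
    unfolding abs_mult by (intro mult_left_mono abs_sin_le_one) auto
  moreover have "Theta_field a l h t x - Theta_field a l' h' t x =
    (2 * a) * (sin (theta t) * (sin (theta t) * sin x)) * (sin h - sin h') + 2 * ((l - l') * sin (theta t))"
    by (simp add: Theta_field_def Theta_rhs_def algebra_simps power2_eq_square)
  moreover have "\<bar>p + 2 * q\<bar> \<le> \<bar>p\<bar> + 2 * \<bar>q\<bar>" for p q :: real by linarith
  ultimately show ?thesis by (smt (verit))
qed

section \<open>Barriers for the angular flow\<close>

text \<open>Subtracting the slope -sin theta of the curve leaves 2 sin theta (1 + l - a A) with A =
  cos^2 + E sin^2 in [0, 1]. Its sign is therefore known at \<open>l\<close> = -1 and at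
  \<open>l\<close> = -1 + a, the ends of the parameter interval.\<close>

lemma Theta_field_on_minus_theta:
  "Theta_field a l h t (- theta t) =
    sin (theta t) * (1 + 2 * l - 2 * a * ((cos (theta t))\<^sup>2 + sin h * (sin (theta t))\<^sup>2))"
  by (simp add: Theta_field_def Theta_rhs_def algebra_simps power2_eq_square)

lemma cos_sq_plus_bounds:
  fixes x :: real
  assumes "0 \<le> E" "E \<le> 1"
  shows "0 \<le> (cos x)\<^sup>2 + E * (sin x)\<^sup>2" "(cos x)\<^sup>2 + E * (sin x)\<^sup>2 \<le> 1"
proof -
  have "E * (sin x)\<^sup>2 \<le> 1 * (sin x)\<^sup>2" using assms by (intro mult_right_mono) auto
  then show "(cos x)\<^sup>2 + E * (sin x)\<^sup>2 \<le> 1" using sin_cos_squared_add[of x] by linarith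
qed (use assms in simp)

lemma minus_theta_has_derivative:
  "((\<lambda>t. - (k * theta t)) has_real_derivative - (k * sin (theta t))) (at t)"
  using theta_has_derivative by (auto intro!: derivative_eq_intros)

lemma Theta_le_minus_theta:
  assumes a: "0 < a" "a < 1 / 2" and E: "0 \<le> sin h"
    and y: "solves (Theta_field a (-1) h) y" and init: "y (- N) = - theta (- N)" and N: "0 \<le> N"
  shows "y N \<le> - theta N"
proof (rule supersolution_ge[OF y Theta_field_lipschitz, where p = "- N"])
  fix t
  let ?A = "(cos (theta t))\<^sup>2 + sin h * (sin (theta t))\<^sup>2"
  have "0 \<le> a * ?A" using a cos_sq_plus_bounds[OF E] by simp
  then have "Theta_field a (-1) h t (- theta t) \<le> sin (theta t) * (- 1)"
    unfolding Theta_field_on_minus_theta using sin_theta_pos[of t]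
    by (intro mult_left_mono) auto
  then show "\<exists>b'. ((\<lambda>t. - theta t) has_real_derivative b') (at t) \<and> Theta_field a (-1) h t (- theta t) \<le> b'"
    using minus_theta_has_derivative[of 1 t] by auto
qed (use a init N in auto)

lemma Theta_ge_minus_theta:
  assumes a: "0 < a" "a < 1 / 2" and E: "0 \<le> sin h"
    and y: "solves (Theta_field a (-1 + a) h) y" and init: "y (- N) = - theta (- N)" and N: "0 \<le> N"
  shows "- theta N \<le> y N"
proof (rule subsolution_le[OF y Theta_field_lipschitz, where p = "- N"])
  fix t
  let ?A = "(cos (theta t))\<^sup>2 + sin h * (sin (theta t))\<^sup>2"
  have "a * ?A \<le> a * 1" using a cos_sq_plus_bounds[OF E, of "theta t"] by (intro mult_left_mono) auto
  then have "sin (theta t) * (- 1) \<le> Theta_field a (-1 + a) h t (- theta t)"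
    unfolding Theta_field_on_minus_theta using sin_theta_pos[of t]
    by (intro mult_left_mono) auto
  then show "\<exists>b'. ((\<lambda>t. - theta t) has_real_derivative b') (at t) \<and> b' \<le> Theta_field a (-1 + a) h t (- theta t)"
    using minus_theta_has_derivative[of 1 t] by auto
qed (use a init N in auto)

text \<open>The barriers 0 and -3 theta do not depend on \<open>N\<close> and both vanish as t tends
  to minus infinity, which gives the left limit once \<open>N\<close> grows.\<close>

lemma Theta_trap:
  assumes a: "0 < a" "a < 1 / 2" and l: "-1 \<le> l" "l \<le> -1 + a" and E: "0 \<le> sin h"
    and y: "solves (Theta_field a l h) y"
    and left: "y (- N) = - theta (- N)" and right: "y N = - theta N" and t: "- N \<le> t" "t \<le> N"
  shows "- (3 * theta t) \<le> y t" "y t \<le> 0"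
proof -
  note lip = Theta_field_lipschitz[OF a l]
  have acos: "\<bar>a * cos (theta s)\<bar> \<le> a" for s
    using a mult_left_mono[OF abs_cos_le_one, of a] by (simp add: abs_mult)
  show "y t \<le> 0"
  proof (rule supersolution_ge[OF y lip _ t(1), where b = "\<lambda>_. 0"])
    fix s
    have "Theta_field a l h s 0 = 2 * (sin (theta s) * (l - a * cos (theta s)))"
      by (simp add: Theta_field_def Theta_rhs_def algebra_simps)
    also have "\<dots> \<le> 0"
      using sin_theta_pos[of s] acos[of s] a l by (simp add: mult_le_0_iff)
    finally show "\<exists>b'. ((\<lambda>_. 0) has_real_derivative b') (at s) \<and> Theta_field a l h s 0 \<le> b'"
      by (intro exI[of _ 0]) auto
  qed (use left theta_bounds[of "-N"] in auto)
  \<comment> \<open>The curve -3 theta is a subsolution only as long as sin (3 theta) >= 0. Once 3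
    theta exceeds pi, it lies below -pi and the bound -pi < y suffices.\<close>
  show "- (3 * theta t) \<le> y t"
  proof (cases "3 * theta t \<le> pi")
    case True
    show ?thesis
    proof (rule subsolution_le[OF y lip _ t(1), where b = "\<lambda>t. - (3 * theta t)"])
      fix s assume s: "s \<le> t"
      have "arctan (exp s) \<le> arctan (exp t)" using s by (simp add: arctan_le_iff)
      then have *: "0 \<le> sin (3 * theta s)"
        using True theta_bounds(1)[of s] by (intro sin_ge_zero) (auto simp: theta_def)
      let ?s = "sin (theta s)" and ?c = "cos (theta s)"
      have "sin h * (?s * ?s) \<le> 1"
        using E sin_theta_pos[of s] by (intro mult_le_one) auto
      then have "2 * a * (sin h * (?s * ?s)) \<le> 1 * 1"
        using a E by (intro mult_mono) auto
      then have "0 \<le> (1 - 2 * a * (sin h * (?s * ?s))) * sin (3 * theta s)"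
        using * by simp
      moreover have "\<bar>a * ?c * cos (3 * theta s)\<bar> \<le> 1/2"
        using acos[of s] a abs_cos_le_one[of "3 * theta s"]
          mult_mono[of "\<bar>a * ?c\<bar>" "1/2" "\<bar>cos (3 * theta s)\<bar>" 1]
        unfolding abs_mult[of "a * ?c"] by linarith
      \<comment> \<open>The factor 3 is 2 + 1: at most 2 from \<open>2 * l\<close> and at most 1
        from the term with \<open>2 * a\<close>.\<close>
      then have "?s * (- 3) \<le> ?s * (2 * l - 2 * (a * ?c * cos (3 * theta s)))"
        using l sin_theta_pos[of s] by (intro mult_left_mono) auto
      ultimately have "- (3 * ?s) \<le> Theta_field a l h s (- (3 * theta s))"
        by (simp add: Theta_field_def Theta_rhs_def algebra_simps power2_eq_square)
      then show "\<exists>b'. ((\<lambda>t. - (3 * theta t)) has_real_derivative b') (at s) \<and> b' \<le> Theta_field a l h s (- (3 * theta s))"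
        using minus_theta_has_derivative by blast
    qed (use left theta_bounds[of "-N"] in auto)
  next
    case False
    \<comment> \<open>The constant -pi is a supersolution, so a solution that reached it could not
      return to the end value -theta N > -pi.\<close>
    have "- pi < y t"
    proof (rule ccontr)
      assume "\<not> - pi < y t"
      have "y N \<le> - pi"
      proof (rule supersolution_ge[OF y lip _ t(2), where b = "\<lambda>_. - pi"])
        fix s
        have "Theta_field a l h s (- pi) = 2 * (sin (theta s) * (l + a * cos (theta s)))"
          by (simp add: Theta_field_def Theta_rhs_def algebra_simps)
        also have "\<dots> \<le> 0"
          using sin_theta_pos[of s] acos[of s] a l by (simp add: mult_le_0_iff)
        finally show "\<exists>b'. ((\<lambda>_. - pi) has_real_derivative b') (at s) \<and> Theta_field a l h s (- pi) \<le> b'"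
          by (intro exI[of _ 0]) auto
      qed (use \<open>\<not> - pi < y t\<close> in auto)
      then show False using right theta_bounds[of N] by simp
    qed
    then show ?thesis using False by simp
  qed
qed

text \<open>Both limits follow by squeezing; the bounds \<open>hi\<close> are the bounds
  \<open>lo\<close> for the reflected solution -pi - y(-t).\<close>

lemma Theta_connectorI:
  assumes y: "solves (Theta_field a l h) y"
    and lo: "\<And>t. - (3 * theta t) \<le> y t" "\<And>t. y t \<le> 0"
    and hi: "\<And>t. - pi \<le> y t" "\<And>t. y t \<le> - pi + 3 * theta (- t)"
  shows "Theta_saddles_connector a (sin h) l"
  unfolding Theta_saddles_connector_def
proof (rule exI[of _ theta], rule exI[of _ y], intro conjI allI)
  show "(theta has_real_derivative sin (theta t)) (at t)" for t by (rule theta_has_derivative)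
  show "(y has_real_derivative Theta_rhs a (sin h) l (theta t) (y t)) (at t)" for t
    using y by (simp add: solves_def Theta_field_def)
  have 1: "((\<lambda>t. - (3 * theta t)) \<longlongrightarrow> - (3 * 0)) at_bot"
    by (intro tendsto_intros theta_at_bot)
  show "(y \<longlongrightarrow> 0) at_bot"
    by (rule tendsto_sandwich[OF _ _ _ tendsto_const, of "\<lambda>t. - (3 * theta t)"]) (use lo 1 in auto)
  have 2: "((\<lambda>t. - pi + 3 * theta (- t)) \<longlongrightarrow> - pi + 3 * (pi - pi)) at_top"
    unfolding theta_minus by (intro tendsto_intros theta_at_top)
  show "(y \<longlongrightarrow> - pi) at_top"
    by (rule tendsto_sandwich[OF _ _ tendsto_const, of _ _ _ "\<lambda>t. - pi + 3 * theta (- t)"]) (use hi 2 in auto)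
qed (use theta_bounds theta_at_bot theta_at_top in auto)

section \<open>The radial flow\<close>

definition Omega_field :: "real \<Rightarrow> real \<Rightarrow> real \<Rightarrow> real \<Rightarrow> real \<Rightarrow> real \<Rightarrow> real" where
  "Omega_field a gam l h t x = Omega_rhs a gam (sin h) l (arctan t) x"

lemma cos_arctan_pos: "0 < cos (arctan t)"
  using arctan_bounded[of t] by (intro cos_gt_zero_pi) auto

lemma sin_arctan_eq: "sin (arctan t) = t * cos (arctan t)"
  by (simp add: sin_arctan cos_arctan)

lemma cos_arctan_sq_le: "(cos (arctan t))\<^sup>2 \<le> cos (arctan t)"
  using cos_arctan_pos[of t] by (simp add: power2_eq_square)

text \<open>Since |sin| <= 1, it dominates sin^2. Hence replacing sin xi by its limit -1 or 1 at an
  end costs only an error of order cos^2 xi.\<close>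

lemma abs_sin_arctan_ge: "1 - (cos (arctan t))\<^sup>2 \<le> \<bar>sin (arctan t)\<bar>"
proof -
  have "(sin (arctan t))\<^sup>2 \<le> \<bar>sin (arctan t)\<bar>"
    using mult_left_mono[OF abs_sin_le_one, of "\<bar>sin (arctan t)\<bar>" "arctan t"]
    by (simp add: power2_eq_square)
  then show ?thesis using sin_cos_squared_add[of "arctan t"] by linarith
qed

lemma cos_arctan_small:
  assumes "0 < c" "1 / c \<le> \<bar>t\<bar>"
  shows "cos (arctan t) \<le> c"
proof -
  have "\<bar>t\<bar> * cos (arctan t) \<le> 1"
    using abs_sin_le_one[of "arctan t"] cos_arctan_pos[of t] by (simp add: sin_arctan_eq abs_mult)
  moreover have "(1 / c) * cos (arctan t) \<le> \<bar>t\<bar> * cos (arctan t)"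
    using assms cos_arctan_pos[of t] by (intro mult_right_mono) auto
  ultimately have "(1 / c) * cos (arctan t) \<le> 1" by linarith
  then show ?thesis using assms by (simp add: field_simps)
qed

lemma cos_arctan_sq: "(cos (arctan t))\<^sup>2 = inverse (1 + t\<^sup>2)"
  by (simp add: cos_arctan power_divide inverse_eq_divide)

lemma arctan_has_derivative: "(arctan has_real_derivative (cos (arctan t))\<^sup>2) (at t)"
  using DERIV_arctan[of t] by (simp add: cos_arctan_sq)

lemma cos_arctan_at_bot: "((\<lambda>t. cos (arctan t)) \<longlongrightarrow> 0) at_bot"
  using tendsto_cos[OF tendsto_arctan_at_bot] by simp

lemma Omega_field_trig:
  "Omega_field a gam l h = trig_field (\<lambda>t. 2 * a * sin (arctan t)) (\<lambda>t. 2 * l * cos (arctan t))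
     (\<lambda>t. 2 * gam * sin (arctan t) * cos (arctan t) + (cos (arctan t))\<^sup>2 - 2 * a * sin h)"
  by (intro ext) (simp add: Omega_field_def Omega_rhs_def trig_field_def algebra_simps)

lemma Omega_field_reflect: "Omega_field a gam l h (- t) (- pi - x) = Omega_field a (- gam) l h t x"
  by (simp add: Omega_field_def Omega_rhs_def arctan_minus sin_diff cos_diff)

lemma Omega_coeffs:
  assumes a: "0 < a" "a < 1 / 2" and gam: "\<bar>gam\<bar> \<le> 1 / 2" and l: "-1 \<le> l" "l \<le> -1 + a"
  shows "\<bar>2 * a * sin (arctan t)\<bar> \<le> 1"
    "\<bar>2 * l * cos (arctan t)\<bar> \<le> 2"
    "\<bar>2 * gam * sin (arctan t) * cos (arctan t) + (cos (arctan t))\<^sup>2 - 2 * a * sin h\<bar> \<le> 3"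
proof -
  have "\<bar>2 * a\<bar> \<le> 1" "\<bar>2 * gam\<bar> \<le> 1" "\<bar>l\<bar> \<le> 1" using a l gam by auto
  note b = this abs_sin_le_one abs_cos_le_one abs_mult_le_one
  show "\<bar>2 * a * sin (arctan t)\<bar> \<le> 1" by (intro b)
  have "\<bar>l * cos (arctan t)\<bar> \<le> 1" by (intro b)
  then show "\<bar>2 * l * cos (arctan t)\<bar> \<le> 2" by linarith
  have 1: "\<bar>2 * gam * sin (arctan t) * cos (arctan t)\<bar> \<le> 1" by (intro b)
  have 2: "\<bar>2 * a * sin h\<bar> \<le> 1" by (intro b)
  have 3: "\<bar>cos (arctan t) * cos (arctan t)\<bar> \<le> 1" by (intro b)
  show "\<bar>2 * gam * sin (arctan t) * cos (arctan t) + (cos (arctan t))\<^sup>2 - 2 * a * sin h\<bar> \<le> 3"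
    using 1 2 3 unfolding power2_eq_square by linarith
qed

lemma Omega_field_lipschitz:
  assumes "0 < a" "a < 1 / 2" "\<bar>gam\<bar> \<le> 1 / 2" "-1 \<le> l" "l \<le> -1 + a"
  shows "\<bar>Omega_field a gam l h t x - Omega_field a gam l h t y\<bar> \<le> 3 * \<bar>x - y\<bar>"
  unfolding Omega_field_trig by (intro trig_field_lipschitz Omega_coeffs[OF assms])

lemma Omega_field_bound:
  assumes "0 < a" "a < 1 / 2" "\<bar>gam\<bar> \<le> 1 / 2" "-1 \<le> l" "l \<le> -1 + a"
  shows "\<bar>Omega_field a gam l h t x\<bar> \<le> 6"
  unfolding Omega_field_trig by (intro trig_field_bound Omega_coeffs[OF assms])

lemma Omega_field_solution:
  assumes "0 < a" "a < 1 / 2" "\<bar>gam\<bar> \<le> 1 / 2" "-1 \<le> l" "l \<le> -1 + a"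
  shows "\<exists>y. y t0 = y0 \<and> solves (Omega_field a gam l h) y"
  unfolding Omega_field_trig
  by (intro trig_field_solution Omega_coeffs[OF assms] continuous_intros)

lemma Omega_field_param:
  assumes a: "0 < a" "a < 1 / 2"
  shows "\<bar>Omega_field a gam l h t x - Omega_field a gam l' h' t x\<bar> \<le> \<bar>h - h'\<bar> + 2 * \<bar>l - l'\<bar>"
proof -
  have "\<bar>(2 * a) * (sin h - sin h')\<bar> \<le> 1 * \<bar>h - h'\<bar>"
    unfolding abs_mult[of "2 * a"] by (intro mult_mono sin_lipschitz) (use a in auto)
  moreover have "\<bar>(l - l') * (cos (arctan t) * sin x)\<bar> \<le> \<bar>l - l'\<bar> * 1"
    unfolding abs_mult[of "l - l'"]
    by (intro mult_left_mono abs_mult_le_one abs_sin_le_one abs_cos_le_one) auto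
  moreover have "Omega_field a gam l h t x - Omega_field a gam l' h' t x =
    2 * ((l - l') * (cos (arctan t) * sin x)) - (2 * a) * (sin h - sin h')"
    by (simp add: Omega_field_def Omega_rhs_def algebra_simps)
  moreover have "\<bar>2 * q - p\<bar> \<le> \<bar>p\<bar> + 2 * \<bar>q\<bar>" for p q :: real by linarith
  ultimately show ?thesis by (smt (verit))
qed

text \<open>Near the left end the field is, up to an error proportional to \<open>cos \<xi>\<close>, the autonomous
  field whose hyperbolic zero is \<open>-\<pi>/2 - h = -\<pi> + arccos (sin h)\<close>.\<close>

lemma Omega_field_left_approx:
  assumes a: "0 < a" "a < 1 / 2" and gam: "\<bar>gam\<bar> \<le> 1 / 2" and l: "-1 \<le> l" "l \<le> -1 + a"
    and t: "t \<le> 0"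
  shows "\<bar>Omega_field a gam l h t (- pi / 2 - w) - 2 * a * (sin w - sin h)\<bar> \<le> 5 * cos (arctan t)"
proof -
  let ?c = "cos (arctan t)" and ?s = "sin (arctan t)"
  have c: "0 < ?c" "?c\<^sup>2 \<le> ?c" using cos_arctan_pos cos_arctan_sq_le by auto
  have s: "?s \<le> 0" "-1 \<le> ?s"
    using mult_nonpos_nonneg[OF t, of ?c] c unfolding sin_arctan_eq[symmetric] by simp_all
  then have "\<bar>1 + ?s\<bar> \<le> ?c" using abs_sin_arctan_ge[of t] c by linarith
  then have "\<bar>1 + ?s\<bar> * \<bar>2 * a * sin w\<bar> \<le> ?c * 1"
    using a c by (intro mult_mono abs_mult_le_one[of "2 * a"]) auto
  then have 1: "\<bar>(1 + ?s) * (2 * a * sin w)\<bar> \<le> ?c" by (simp add: abs_mult)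
  have "?c * \<bar>l * cos w\<bar> \<le> ?c * 1"
    using l a c by (intro mult_left_mono abs_mult_le_one) auto
  then have 2: "\<bar>?c * (l * cos w)\<bar> \<le> ?c" using c by (simp add: abs_mult)
  have "?c * \<bar>2 * gam * ?s\<bar> \<le> ?c * 1"
    using gam c by (intro mult_left_mono abs_mult_le_one[of "2 * gam"]) auto
  then have 3: "\<bar>?c * (2 * gam * ?s)\<bar> \<le> ?c" using c by (simp add: abs_mult)
  have "cos (- pi / 2 - w) = - sin w" "sin (- pi / 2 - w) = - cos w"
    by (simp_all add: cos_diff sin_diff)
  \<comment> \<open>The four error terms contribute 1, 2, 1 and 1 times \<open>?c\<close>, whence
    the constant 5.\<close>
  then have "Omega_field a gam l h t (- pi / 2 - w) - 2 * a * (sin w - sin h) =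
     - ((1 + ?s) * (2 * a * sin w)) - 2 * (?c * (l * cos w)) + ?c * (2 * gam * ?s) + ?c\<^sup>2"
    by (simp add: Omega_field_def Omega_rhs_def algebra_simps)
  moreover have "\<bar>- p - 2 * q + r + u\<bar> \<le> \<bar>p\<bar> + 2 * \<bar>q\<bar> + \<bar>r\<bar> + u" if "0 \<le> u" for p q r u :: real
    using that by linarith
  from this[of "?c\<^sup>2" "(1 + ?s) * (2 * a * sin w)" "?c * (l * cos w)" "?c * (2 * gam * ?s)"]
  have "\<bar>- ((1 + ?s) * (2 * a * sin w)) - 2 * (?c * (l * cos w)) + ?c * (2 * gam * ?s) + ?c\<^sup>2\<bar> \<le> 5 * ?c"
    using 1 2 3 c by (smt (verit) zero_le_power2)
  ultimately show ?thesis by (simp only:)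
qed

section \<open>Barriers at the left saddle of the radial flow\<close>

text \<open>The derivative cos z is at least cos b on [-b, b]. This gives the attraction towards the
  zero of the limiting field a rate that is uniform in \<open>h\<close>.\<close>

lemma sin_increment:
  assumes "0 \<le> h" "0 \<le> d" "h + d \<le> b" "b \<le> pi"
  shows "cos b * d \<le> sin (h + d) - sin h" "cos b * d \<le> sin h - sin (h - d)"
proof -
  have *: "cos b * d \<le> sin (x + d) - sin x" if x: "- b \<le> x" "x + d \<le> b" for x
  proof -
    have "sin x - cos b * x \<le> sin (x + d) - cos b * (x + d)"
    proof (rule DERIV_nonneg_imp_nondecreasing[where f = "\<lambda>z. sin z - cos b * z"])
      fix z assume z: "x \<le> z" "z \<le> x + d"
      have "cos b \<le> cos \<bar>z\<bar>" using x z assms by (intro cos_monotone_0_pi_le) auto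
      then have "0 \<le> cos z - cos b" by (simp add: abs_if split: if_splits)
      moreover have "((\<lambda>z. sin z - cos b * z) has_real_derivative cos z - cos b) (at z)"
        by (auto intro!: derivative_eq_intros)
      ultimately show "\<exists>y. ((\<lambda>z. sin z - cos b * z) has_real_derivative y) (at z) \<and> 0 \<le> y" by blast
    qed (use assms in auto)
    then show ?thesis by (simp add: algebra_simps)
  qed
  show "cos b * d \<le> sin (h + d) - sin h" "cos b * d \<le> sin h - sin (h - d)"
    using *[of h] *[of "h - d"] assms by auto
qed

text \<open>At distance \<open>A\<close> cos xi from the saddle value the limiting field points
  inwards with strength at least 2 a cos(h1 + d) A cos xi = 6 cos xi, which beats the error 5 cos
  xi. For t < 0 the barriers also widen with time. The condition on \<open>T\<close> keeps all
  angles below h1 + d, where this rate holds.\<close>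

lemma Omega_trap:
  assumes a: "0 < a" "a < 1 / 2" and gam: "\<bar>gam\<bar> \<le> 1 / 2" and l: "-1 \<le> l" "l \<le> -1 + a"
    and h: "0 \<le> h" "h \<le> h1" and d: "0 \<le> d" "h1 + d < pi / 2"
    and A: "A * a * cos (h1 + d) = 3"
    and T: "\<And>t. t \<le> - T \<Longrightarrow> A * cos (arctan t) \<le> d" "0 \<le> T"
    and y: "solves (Omega_field a gam l h) y" and init: "y (- N) = - pi / 2 - h * sin (arctan N)"
    and t: "- N \<le> t" "t \<le> - T"
  shows "\<bar>y t - (- pi / 2 - h)\<bar> \<le> A * cos (arctan t)"
proof -
  note lip = Omega_field_lipschitz[OF a gam l]
  let ?k = "cos (h1 + d)"
  have k: "0 < ?k" using h d by (intro cos_gt_zero_pi) auto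
  have k1: "a * ?k \<le> 1/2 * 1" using k a by (intro mult_mono) auto
  have A0: "0 < A" using A a k by (metis mult_pos_pos zero_less_mult_pos2 zero_less_numeral)
  have A6: "6 \<le> A"
  proof -
    have "A * (a * ?k) \<le> A * (1/2 * 1)" using A0 k1 by (intro mult_left_mono) auto
    then show ?thesis using A by (simp add: mult.assoc)
  qed
  \<comment> \<open>The starting value misses the saddle value by h (1 - sin), which is at most h
    cos; \<open>A\<close> >= 6 exceeds \<open>h\<close>, so it lies between the barriers.\<close>
  have init2: "0 \<le> h * (1 - sin (arctan N))" "h * (1 - sin (arctan N)) \<le> A * cos (arctan (- N))"
  proof -
    have N: "0 \<le> N" using t T by linarith
    then have "0 \<le> sin (arctan N)" using cos_arctan_pos[of N] by (simp add: sin_arctan_eq)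
    then have 1: "1 - sin (arctan N) \<le> cos (arctan N)"
      using abs_sin_arctan_ge[of N] cos_arctan_sq_le[of N] by linarith
    show "0 \<le> h * (1 - sin (arctan N))" using h by simp
    have "h * (1 - sin (arctan N)) \<le> A * cos (arctan N)"
      using 1 A6 h d pi_less_4 by (intro mult_mono) auto
    then show "h * (1 - sin (arctan N)) \<le> A * cos (arctan (- N))" by (simp add: arctan_minus)
  qed
  have key: "0 \<le> Omega_field a gam l h s (- pi / 2 - h - A * cos (arctan s))"
    "Omega_field a gam l h s (- pi / 2 - h + A * cos (arctan s)) \<le> 0" if s: "s \<le> t" for s
  proof -
    let ?c = "cos (arctan s)"
    have s0: "s \<le> 0" using s t T by auto
    have c: "0 < ?c" by (rule cos_arctan_pos)
    have x: "0 \<le> A * ?c" "A * ?c \<le> d" using c A0 T(1)[of s] s t by auto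
    have inc: "?k * (A * ?c) \<le> sin (h + A * ?c) - sin h" "?k * (A * ?c) \<le> sin h - sin (h - A * ?c)"
      by (intro sin_increment; use h d x in auto)+
    have "2 * a * (?k * (A * ?c)) = 2 * (A * a * ?k) * ?c" by simp
    then have e: "2 * a * (?k * (A * ?c)) = 6 * ?c" by (simp add: A)
    have "6 * ?c \<le> 2 * a * (sin (h + A * ?c) - sin h)"
      unfolding e[symmetric] using a by (intro mult_left_mono inc) auto
    then show "0 \<le> Omega_field a gam l h s (- pi / 2 - h - A * ?c)"
      using Omega_field_left_approx[OF a gam l s0, of h "h + A * ?c"] c by (simp add: diff_diff_eq)
    have "6 * ?c \<le> 2 * a * (sin h - sin (h - A * ?c))"
      unfolding e[symmetric] using a by (intro mult_left_mono inc) auto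
    then have "2 * a * (sin (h - A * ?c) - sin h) \<le> - 6 * ?c" by (simp add: algebra_simps)
    then show "Omega_field a gam l h s (- pi / 2 - h + A * ?c) \<le> 0"
      using Omega_field_left_approx[OF a gam l s0, of h "h - A * ?c"] c by (simp add: algebra_simps)
  qed
  have der: "0 \<le> - (A * (sin (arctan s) * (cos (arctan s))\<^sup>2))" if "s \<le> t" for s
    using that t T A0 cos_arctan_pos[of s] by (simp add: sin_arctan_eq mult_le_0_iff zero_le_mult_iff)
  have "- pi / 2 - h - A * cos (arctan t) \<le> y t"
  proof (rule subsolution_le[OF y lip _ t(1)])
    fix s assume s: "s \<le> t"
    have "((\<lambda>t. - pi / 2 - h - A * cos (arctan t)) has_real_derivative
        - (- (A * (sin (arctan s) * (cos (arctan s))\<^sup>2)))) (at s)"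
      by (auto intro!: derivative_eq_intros simp: cos_arctan_sq)
    moreover have "- (- (A * (sin (arctan s) * (cos (arctan s))\<^sup>2))) \<le> Omega_field a gam l h s (- pi / 2 - h - A * cos (arctan s))"
      using der[OF s] key(1)[OF s] by linarith
    ultimately show "\<exists>b'. ((\<lambda>t. - pi / 2 - h - A * cos (arctan t)) has_real_derivative b') (at s) \<and>
        b' \<le> Omega_field a gam l h s (- pi / 2 - h - A * cos (arctan s))" by blast
  next
    show "- pi / 2 - h - A * cos (arctan (- N)) \<le> y (- N)"
      using init init2 by (simp add: algebra_simps)
  qed
  moreover have "y t \<le> - pi / 2 - h + A * cos (arctan t)"
  proof (rule supersolution_ge[OF y lip _ t(1)])
    fix s assume s: "s \<le> t"
    have "((\<lambda>t. - pi / 2 - h + A * cos (arctan t)) has_real_derivative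
        - (A * (sin (arctan s) * (cos (arctan s))\<^sup>2))) (at s)"
      by (auto intro!: derivative_eq_intros simp: cos_arctan_sq)
    moreover have "Omega_field a gam l h s (- pi / 2 - h + A * cos (arctan s)) \<le> - (A * (sin (arctan s) * (cos (arctan s))\<^sup>2))"
      using der[OF s] key(2)[OF s] by linarith
    ultimately show "\<exists>b'. ((\<lambda>t. - pi / 2 - h + A * cos (arctan t)) has_real_derivative b') (at s) \<and>
        Omega_field a gam l h s (- pi / 2 - h + A * cos (arctan s)) \<le> b'" by blast
  next
    show "y (- N) \<le> - pi / 2 - h + A * cos (arctan (- N))"
      using init init2 by (simp add: algebra_simps)
  qed
  ultimately show ?thesis by linarith
qed

section \<open>The two edges of the energy range\<close>

text \<open>The curve -pi/2 + e sin xi joins the two saddle values. In the field along it, the cos^2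
  xi term pays for the defect 2a (sin e - sin xi sin(e sin xi)), and the remaining terms are at
  least e cos xi, hence at least the slope e cos^3 xi. The value of \<open>e\<close> makes 2(1 -
  a)(1 - e/2) - 1 >= e.\<close>

lemma Omega_low_energy:
  assumes a: "0 < a" "a < 1 / 2" and gam: "\<bar>gam\<bar> \<le> 1 / 2" and l: "-1 \<le> l" "l \<le> -1 + a"
    and e: "e = (1 - 2 * a) / 2"
    and y: "solves (Omega_field a gam l e) y" and init: "y (- N) = - pi / 2 - e * sin (arctan N)"
    and N: "0 \<le> N"
  shows "- pi / 2 + e * sin (arctan N) \<le> y N"
proof (rule subsolution_le[OF y Omega_field_lipschitz[OF a gam l], where p = "- N"
      and b = "\<lambda>t. - pi / 2 + e * sin (arctan t)"])
  fix t
  let ?c = "cos (arctan t)" and ?s = "sin (arctan t)"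
  have e01: "0 < e" "e < 1/2" using a e by auto
  have c: "0 < ?c" "?c\<^sup>2 \<le> ?c" "?c \<le> 1" using cos_arctan_pos cos_arctan_sq_le by auto
  have s: "1 - \<bar>?s\<bar> \<le> ?c\<^sup>2" "\<bar>?s\<bar> \<le> 1" using abs_sin_arctan_ge[of t] by auto
  have "\<bar>e * ?s\<bar> \<le> e" using e01 s by (simp add: abs_mult)
  have sinpos: "0 \<le> sin (e * \<bar>?s\<bar>)" "sin (e * \<bar>?s\<bar>) \<le> e * \<bar>?s\<bar>"
    using e01 pi_gt3 order_trans[OF \<open>\<bar>e * ?s\<bar> \<le> e\<close>, of pi]
    by (auto intro!: sin_ge_zero sin_x_le_x simp: abs_mult)
  \<comment> \<open>The defect splits into a change of the argument and a change of the factor |sin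
    xi|, each costing at most e cos^2 xi; then 2a < 1 and 2e < 1 finish.\<close>
  have "sin e - sin (e * \<bar>?s\<bar>) \<le> \<bar>e - e * \<bar>?s\<bar>\<bar>"
    using sin_lipschitz[of e "e * \<bar>?s\<bar>"] by linarith
  also have "\<dots> = e * (1 - \<bar>?s\<bar>)"
  proof -
    have "e - e * \<bar>?s\<bar> = e * (1 - \<bar>?s\<bar>)" by (simp add: algebra_simps)
    moreover have "0 \<le> e * (1 - \<bar>?s\<bar>)" using e01 s by (intro mult_nonneg_nonneg) auto
    ultimately show ?thesis by (simp only: abs_of_nonneg)
  qed
  also have "\<dots> \<le> e * ?c\<^sup>2" using e01 s by (intro mult_left_mono) auto
  finally have 1: "sin e - sin (e * \<bar>?s\<bar>) \<le> e * ?c\<^sup>2" .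
  have "(1 - \<bar>?s\<bar>) * sin (e * \<bar>?s\<bar>) \<le> ?c\<^sup>2 * e"
  proof (intro mult_mono)
    have "e * \<bar>?s\<bar> \<le> e * 1" using e01 s by (intro mult_left_mono) auto
    then show "sin (e * \<bar>?s\<bar>) \<le> e" using sinpos by linarith
  qed (use s sinpos in auto)
  then have "sin (e * \<bar>?s\<bar>) - \<bar>?s\<bar> * sin (e * \<bar>?s\<bar>) \<le> e * ?c\<^sup>2" by (simp add: algebra_simps)
  moreover have "\<bar>?s\<bar> * sin (e * \<bar>?s\<bar>) = ?s * sin (e * ?s)" by (simp add: abs_if)
  ultimately have "sin e - ?s * sin (e * ?s) \<le> 2 * (e * ?c\<^sup>2)" using 1 by linarith
  then have "2 * a * (sin e - ?s * sin (e * ?s)) \<le> 2 * a * (2 * (e * ?c\<^sup>2))"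
    using a by (intro mult_left_mono) auto
  also have "\<dots> \<le> 1 * (2 * (e * ?c\<^sup>2))" using a e01 by (intro mult_right_mono) auto
  also have "\<dots> \<le> ?c\<^sup>2"
    using mult_right_mono[of "2 * e" 1 "?c\<^sup>2"] e01 by simp
  finally have 2: "2 * a * (sin e - ?s * sin (e * ?s)) \<le> ?c\<^sup>2" .
  have cosge: "1 - e / 2 \<le> cos (e * ?s)"
  proof -
    have "1 - cos (e * ?s) = 2 * (sin (e * ?s / 2))\<^sup>2" using cos_double_sin[of "e * ?s / 2"] by simp
    also have "\<dots> \<le> 2 * \<bar>e * ?s / 2\<bar>\<^sup>2"
      using power_mono[OF abs_sin_x_le_abs_x[of "e * ?s / 2"], of 2] by simp
    also have "\<dots> \<le> 2 * (e / 2)\<^sup>2"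
      using \<open>\<bar>e * ?s\<bar> \<le> e\<close> by (intro mult_left_mono power_mono) auto
    also have "\<dots> = e * e / 2" by (simp add: power2_eq_square)
    also have "\<dots> \<le> e * 1 / 2" using e01 by (intro divide_right_mono mult_left_mono) auto
    finally show ?thesis by simp
  qed
  have "(1 - a) * (1 - e / 2) \<le> (- l) * cos (e * ?s)"
    using cosge l a e01 by (intro mult_mono) auto
  moreover have "2 * ((1 - a) * (1 - e / 2)) \<ge> 1 + e"
  proof -
    have "2 * ((1 - a) * (1 - e / 2)) - (1 + e) = (1 - 2 * a) - 2 * e + e * a"
      by (simp add: field_simps)
    moreover have "2 * e = 1 - 2 * a" by (simp add: e)
    ultimately show ?thesis using a e01 by (smt (verit) mult_pos_pos)
  qed
  moreover have "\<bar>2 * gam * ?s\<bar> \<le> 1" using gam by (intro abs_mult_le_one[of "2 * gam"]) auto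
  ultimately have "e \<le> - (2 * l * cos (e * ?s)) + 2 * gam * ?s" by linarith
  then have "?c * e \<le> ?c * (- (2 * l * cos (e * ?s)) + 2 * gam * ?s)"
    using c by (intro mult_left_mono) auto
  moreover have "?c\<^sup>2 \<le> 1" using c by linarith
  then have "e * (?c * ?c\<^sup>2) \<le> e * (?c * 1)" using c e01 by (intro mult_left_mono) linarith+
  moreover have "cos (- pi / 2 + e * ?s) = sin (e * ?s)" "sin (- pi / 2 + e * ?s) = - cos (e * ?s)"
    by (simp_all add: cos_diff sin_diff)
  ultimately have "e * (?c * ?c\<^sup>2) \<le> Omega_field a gam l e t (- pi / 2 + e * ?s)"
    using 2 by (simp add: Omega_field_def Omega_rhs_def algebra_simps)
  moreover have "((\<lambda>t. - pi / 2 + e * sin (arctan t)) has_real_derivative e * (?c * ?c\<^sup>2)) (at t)"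
    by (auto intro!: derivative_eq_intros simp: cos_arctan_sq)
  ultimately show "\<exists>b'. ((\<lambda>t. - pi / 2 + e * sin (arctan t)) has_real_derivative b') (at t) \<and>
      b' \<le> Omega_field a gam l e t (- pi / 2 + e * sin (arctan t))" by blast
qed (use N init in \<open>auto simp: arctan_minus\<close>)

text \<open>Four successive barriers: 0 on [-N, -T], linear growth at the maximal speed 6 on
  [-T, T], a logarithmic descent to -4 on [T, T2], and the constant -pi up to N. The witness for the
  threshold is \<open>T2\<close>.\<close>

lemma Omega_winds_down:
  assumes a: "0 < a" "a < 1 / 2" and gam: "- (1 / 2) \<le> gam" "gam < 0"
  shows "\<exists>h1 T. 1 \<le> h1 \<and> h1 < pi / 2 \<and> (\<forall>l y N. -1 \<le> l \<longrightarrow> l \<le> -1 + a \<longrightarrow> T \<le> N \<longrightarrow>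
    solves (Omega_field a gam l h1) y \<longrightarrow> y (- N) = - pi / 2 - h1 * sin (arctan N) \<longrightarrow> y N \<le> - pi)"
proof -
  define g where "g = - gam"
  have g: "0 < g" "g \<le> 1 / 2" "\<bar>gam\<bar> \<le> 1 / 2" using gam by (auto simp: g_def)
  \<comment> \<open>The constants are chosen in this order: \<open>c0\<close> makes the terms
    quadratic in cos xi at most a quarter of g cos xi; \<open>T\<close> is the time beyond which cos
    xi <= \<open>c0\<close>; \<open>T2\<close> lets the logarithm fall from 12 T to -4;
    \<open>\<delta>\<close> makes the energy deficit 1 - sin h1 negligible up to \<open>T2\<close>.
    Only \<open>\<delta>\<close> affects the energy, and \<open>T2\<close> is fixed before
    it.\<close>
  define c0 where "c0 = g * a / 8"
  define T where "T = 1 / c0"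
  define T2 where "T2 = T * exp ((4 / g) * (12 * T + 4))"
  define \<delta> where "\<delta> = g / (8 * T2)"
  define h1 where "h1 = pi / 2 - \<delta>"
  have c0: "0 < c0" "c0 \<le> a / 16"
    using g a mult_right_mono[of g "1/2" a] by (auto simp: c0_def)
  have T: "1 \<le> T" using c0 a by (simp add: T_def)
  have T2: "T \<le> T2" using T g by (simp add: T2_def)
  have \<delta>: "0 < \<delta>" "\<delta> \<le> 1 / 16" using g T T2 by (auto simp: \<delta>_def field_simps)
  have h1: "1 \<le> h1" "h1 < pi / 2" using \<delta> pi_gt3 by (auto simp: h1_def)
  have E: "1 - \<delta> \<le> sin h1" "0 \<le> sin h1"
  proof -
    have "sin h1 = cos \<delta>" by (simp add: h1_def sin_diff)
    then show "1 - \<delta> \<le> sin h1" using cos_lipschitz[of 0 \<delta>] \<delta> by simp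
    then show "0 \<le> sin h1" using \<delta> by linarith
  qed
  have far: "0 < cos (arctan t)" "cos (arctan t) \<le> c0" "(cos (arctan t))\<^sup>2 \<le> cos (arctan t)"
    "3 / 4 \<le> \<bar>sin (arctan t)\<bar>" if "T \<le> \<bar>t\<bar>" for t
  proof -
    show 1: "0 < cos (arctan t)" by (rule cos_arctan_pos)
    show 2: "cos (arctan t) \<le> c0" using that c0 by (intro cos_arctan_small) (auto simp: T_def)
    show 3: "(cos (arctan t))\<^sup>2 \<le> cos (arctan t)" by (rule cos_arctan_sq_le)
    show "3 / 4 \<le> \<bar>sin (arctan t)\<bar>" using abs_sin_arctan_ge[of t] 2 3 c0 a by linarith
  qed
  have sgn: "sin (arctan t) \<le> - 3 / 4" if "t \<le> - T" for t
  proof -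
    have "sin (arctan t) \<le> 0" unfolding sin_arctan_eq using that T cos_arctan_pos[of t]
      by (intro mult_nonpos_nonneg) auto
    moreover have "T \<le> \<bar>t\<bar>" using that T by auto
    ultimately show ?thesis using far(4)[of t] by linarith
  qed
  have sgn': "3 / 4 \<le> sin (arctan t)" if "T \<le> t" for t
    using sgn[of "- t"] that by (simp add: arctan_minus)
  have "y N \<le> - pi"
    if l: "-1 \<le> l" "l \<le> -1 + a" and N: "T2 \<le> N" and y: "solves (Omega_field a gam l h1) y"
      and init: "y (- N) = - pi / 2 - h1 * sin (arctan N)" for l y N
  proof -
    note lip = Omega_field_lipschitz[OF a g(3) l]
    have "y (- T) \<le> 0"
    proof (rule supersolution_ge[OF y lip, where b = "\<lambda>_. 0" and p = "- N"])
      fix t assume t: "t \<le> - T"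
      let ?c = "cos (arctan t)" and ?s = "sin (arctan t)"
      note f = far[of t] sgn[OF t]
      have "2 * a * ?s \<le> 2 * a * (- 3 / 4)" using f a by (intro mult_left_mono) auto
      moreover have "\<bar>2 * gam * ?s * ?c\<bar> \<le> 1 * ?c"
        unfolding abs_mult[of "2 * gam * ?s"] using g f t T
        by (intro mult_mono abs_mult_le_one[of "2 * gam"]) auto
      moreover have "0 \<le> a * sin h1" using a E by simp
      ultimately have "Omega_field a gam l h1 t 0 \<le> 0"
        using f t T c0 by (simp add: Omega_field_def Omega_rhs_def)
      then show "\<exists>b'. ((\<lambda>_. 0) has_real_derivative b') (at t) \<and> Omega_field a gam l h1 t 0 \<le> b'"
        by (intro exI[of _ 0]) auto
    next
      have "0 \<le> h1 * sin (arctan N)" using sgn'[of N] N T2 h1 by (intro mult_nonneg_nonneg) auto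
      then show "y (- N) \<le> 0" using init pi_gt_zero by linarith
    qed (use N T2 in auto)
    have "y T \<le> 6 * (T + T)"
    proof (rule supersolution_ge[OF y lip, where b = "\<lambda>t. 6 * (t + T)" and p = "- T"])
      fix t
      have "((\<lambda>t. 6 * (t + T)) has_real_derivative 6) (at t)"
        by (auto intro!: derivative_eq_intros)
      then show "\<exists>b'. ((\<lambda>t. 6 * (t + T)) has_real_derivative b') (at t) \<and>
          Omega_field a gam l h1 t (6 * (t + T)) \<le> b'"
        using Omega_field_bound[OF a g(3) l] abs_le_D1 by blast
    qed (use T \<open>y (- T) \<le> 0\<close> in auto)
    have "y T2 \<le> 12 * T - g / 4 * (ln T2 - ln T)"
    proof (rule supersolution_ge[OF y lip, where b = "\<lambda>t. 12 * T - g / 4 * (ln t - ln T)" and p = T])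
      fix t assume t: "T \<le> t" "t \<le> T2"
      let ?c = "cos (arctan t)" and ?s = "sin (arctan t)"
      define x where "x = 12 * T - g / 4 * (ln t - ln T)"
      have t0: "0 < t" using t T by auto
      have f: "0 < ?c" "?c \<le> c0" "?c\<^sup>2 \<le> ?c" "3 / 4 \<le> ?s" "?s \<le> 1"
        using far[of t] sgn'[of t] t T by auto
      have gc: "3 * g / (4 * t) \<le> g * ?c"
      proof -
        have "(g / t) * (3 / 4) \<le> (g / t) * ?s" using f g t0 by (intro mult_left_mono) auto
        then show ?thesis using t0 by (simp add: sin_arctan_eq)
      qed
      have "2 * a * ((?s - 1) * cos x) \<le> 1 * ?c\<^sup>2"
      proof -
        have "\<bar>(?s - 1) * cos x\<bar> \<le> ?c\<^sup>2 * 1"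
          unfolding abs_mult using f abs_sin_arctan_ge[of t] by (intro mult_mono) auto
        then have "2 * a * ((?s - 1) * cos x) \<le> 2 * a * ?c\<^sup>2" using a by (intro mult_left_mono) auto
        also have "\<dots> \<le> 1 * ?c\<^sup>2" using a by (intro mult_right_mono) auto
        finally show ?thesis .
      qed
      \<comment> \<open>The spare term -a sin^2 x is kept to absorb the cross term 2 l cos xi sin x
        by completing a square, at the price cos^2 xi / a.\<close>
      moreover have "2 * a * cos x \<le> 2 * a - a * (sin x)\<^sup>2"
      proof -
        have "0 \<le> (1 - cos x)\<^sup>2" by simp
        then have "2 * cos x \<le> 1 + (cos x)\<^sup>2" by (simp add: power2_diff)
        then have "2 * cos x \<le> 2 - (sin x)\<^sup>2"
          using sin_cos_squared_add[of x] by linarith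
        then have "a * (2 * cos x) \<le> a * (2 - (sin x)\<^sup>2)" using a by (intro mult_left_mono) auto
        then show ?thesis by (simp add: algebra_simps)
      qed
      moreover have "2 * (l * ?c * sin x) \<le> a * (sin x)\<^sup>2 + ?c\<^sup>2 / a"
      proof -
        have "l * (?c * sin x) \<le> \<bar>l\<bar> * \<bar>?c * sin x\<bar>"
          unfolding abs_mult[of l, symmetric] by (rule abs_ge_self)
        also have "\<dots> \<le> 1 * \<bar>?c * sin x\<bar>" using l a by (intro mult_right_mono) auto
        finally have "l * ?c * sin x \<le> ?c * \<bar>sin x\<bar>" using f by (simp add: abs_mult mult.assoc)
        moreover have "0 \<le> (a * \<bar>sin x\<bar> - ?c)\<^sup>2 / a" using a by simp
        then have "2 * (?c * \<bar>sin x\<bar>) \<le> a * (sin x)\<^sup>2 + ?c\<^sup>2 / a"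
          using a by (simp add: power2_diff power_mult_distrib field_simps power2_eq_square)
        ultimately show ?thesis by linarith
      qed
      moreover have "2 * ?c\<^sup>2 + ?c\<^sup>2 / a \<le> g * ?c / 4"
      proof -
        have "2 * ?c\<^sup>2 + ?c\<^sup>2 / a = ?c * ?c * (2 + 1 / a)" by (simp add: power2_eq_square algebra_simps)
        also have "\<dots> \<le> ?c * c0 * (2 / a)"
          using f a c0 by (intro mult_mono) (auto simp: field_simps)
        also have "\<dots> = g * ?c / 4" using a by (simp add: c0_def)
        finally show ?thesis .
      qed
      moreover have "(3 / 2) * (g * ?c) \<le> - (2 * gam * ?s * ?c)"
      proof -
        have "(2 * g * ?c) * (3 / 4) \<le> (2 * g * ?c) * ?s" using f g by (intro mult_left_mono) auto
        then show ?thesis by (simp add: g_def algebra_simps)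
      qed
      moreover have "2 * a * (1 - sin h1) \<le> g * ?c / 4"
      proof -
        have "2 * a * (1 - sin h1) \<le> 1 * \<delta>" using a E by (intro mult_mono) auto
        also have "\<delta> \<le> g / (8 * t)" using t t0 g by (auto simp: \<delta>_def intro!: divide_left_mono)
        also have "\<dots> \<le> (3 * g / (4 * t)) / 4" using g t0 by (simp add: field_simps)
        also have "\<dots> \<le> g * ?c / 4" using gc by simp
        finally show ?thesis by simp
      qed
      moreover have "Omega_field a gam l h1 t x = 2 * a * ((?s - 1) * cos x) + 2 * a * cos x
          + 2 * (l * ?c * sin x) + 2 * gam * ?s * ?c + ?c\<^sup>2 - 2 * a + 2 * a * (1 - sin h1)"
        by (simp add: Omega_field_def Omega_rhs_def algebra_simps)
      \<comment> \<open>The Coulomb term gives -3/2 g cos xi and the two quarters leave -g cos xi.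
        As cos xi >= 3/(4t) here, this lies below the slope -g/(4t) of the logarithmic
        barrier.\<close>
      ultimately have "Omega_field a gam l h1 t x \<le> - (g * ?c)" by linarith
      also have "\<dots> \<le> - (g / 4 * (1 / t))" using gc g t0 by (simp add: field_simps)
      finally have "Omega_field a gam l h1 t x \<le> - (g / 4 * (1 / t))" .
      moreover have "((\<lambda>t. 12 * T - g / 4 * (ln t - ln T)) has_real_derivative - (g / 4 * (1 / t))) (at t)"
        using t0 by (auto intro!: derivative_eq_intros)
      ultimately show "\<exists>b'. ((\<lambda>t. 12 * T - g / 4 * (ln t - ln T)) has_real_derivative b') (at t) \<and>
          Omega_field a gam l h1 t (12 * T - g / 4 * (ln t - ln T)) \<le> b'"
        unfolding x_def by blast
    qed (use T T2 \<open>y T \<le> 6 * (T + T)\<close> in auto)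
    also have "12 * T - g / 4 * (ln T2 - ln T) = - 4"
    proof -
      have "ln T2 - ln T = 4 / g * (12 * T + 4)" using T by (simp add: T2_def ln_mult)
      then have "g / 4 * (ln T2 - ln T) = 12 * T + 4" using g by simp
      then show ?thesis by linarith
    qed
    finally have "y T2 \<le> - pi" using pi_less_4 by linarith
    show "y N \<le> - pi"
    proof (rule supersolution_ge[OF y lip _ N, where b = "\<lambda>_. - pi"])
      fix t assume t: "T2 \<le> t"
      let ?c = "cos (arctan t)" and ?s = "sin (arctan t)"
      have f: "0 < ?c" "?c \<le> c0" "?c\<^sup>2 \<le> ?c" "3 / 4 \<le> ?s"
        using far[of t] sgn'[of t] t T T2 by auto
      have "2 * a * (3 / 4) \<le> 2 * a * ?s" using f a by (intro mult_left_mono) auto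
      moreover have "0 \<le> g * ?s * ?c" using g f by simp
      moreover have "0 \<le> a * sin h1" using a E by simp
      moreover have "Omega_field a gam l h1 t (- pi) =
          - (2 * a * ?s) - 2 * (g * ?s * ?c) + ?c\<^sup>2 - 2 * (a * sin h1)"
        by (simp add: Omega_field_def Omega_rhs_def g_def)
      ultimately have "Omega_field a gam l h1 t (- pi) \<le> 0" using f c0 a by linarith
      then show "\<exists>b'. ((\<lambda>_. - pi) has_real_derivative b') (at t) \<and> Omega_field a gam l h1 t (- pi) \<le> b'"
        by (intro exI[of _ 0]) auto
    qed (use \<open>y T2 \<le> - pi\<close> in auto)
  qed
  then show ?thesis using h1 by (intro exI[of _ h1] exI[of _ T2]) blast
qed

section \<open>From trapped solutions to a radial connector\<close>

lemma Omega_connectorI: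
  assumes y: "solves (Omega_field a gam l h) y" and h: "0 \<le> h" "h \<le> pi / 2"
    and left: "\<And>t. t \<le> - T \<Longrightarrow> \<bar>y t - (- pi / 2 - h)\<bar> \<le> A * cos (arctan t)"
    and right: "\<And>t. t \<le> - T \<Longrightarrow> \<bar>- pi - y (- t) - (- pi / 2 - h)\<bar> \<le> A * cos (arctan t)"
  shows "Omega_saddles_connector a gam (sin h) l"
proof -
  \<comment> \<open>On 0 <= h <= pi/2 the principal branch turns the saddle values -pi/2 - h and
    -pi/2 + h into the prescribed limits.\<close>
  have arc: "arccos (sin h) = pi / 2 - h"
    using arccos_cos[of "pi / 2 - h"] h by (simp add: cos_diff)
  have "((\<lambda>t. A * cos (arctan t)) \<longlongrightarrow> A * 0) at_bot"
    by (intro tendsto_intros cos_arctan_at_bot)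
  then have bot: "((\<lambda>t. A * cos (arctan t)) \<longlongrightarrow> 0) at_bot" by simp
  have "eventually (\<lambda>t. norm (y t - (- pi / 2 - h)) \<le> A * cos (arctan t)) at_bot"
    using eventually_le_at_bot[of "- T"] by eventually_elim (simp only: real_norm_def left)
  then have "((\<lambda>t. y t - (- pi / 2 - h)) \<longlongrightarrow> 0) at_bot"
    by (rule Lim_null_comparison[OF _ bot])
  then have "(y \<longlongrightarrow> - pi / 2 - h) at_bot" by (rule LIM_zero_cancel)
  moreover have "- pi + arccos (sin h) = - pi / 2 - h" by (simp add: arc)
  ultimately have yl: "(y \<longlongrightarrow> - pi + arccos (sin h)) at_bot" by (simp only:)
  have "eventually (\<lambda>t. norm (- pi - y (- t) - (- pi / 2 - h)) \<le> A * cos (arctan t)) at_bot"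
    using eventually_le_at_bot[of "- T"] by eventually_elim (simp only: real_norm_def right)
  then have "((\<lambda>t. - pi - y (- t) - (- pi / 2 - h)) \<longlongrightarrow> 0) at_bot"
    by (rule Lim_null_comparison[OF _ bot])
  then have "((\<lambda>t. - pi - y (- t)) \<longlongrightarrow> - pi / 2 - h) at_bot" by (rule LIM_zero_cancel)
  then have "((\<lambda>t. - pi - (- pi - y (- t))) \<longlongrightarrow> - pi - (- pi / 2 - h)) at_bot"
    by (rule tendsto_diff[OF tendsto_const])
  moreover have "- pi - (- pi / 2 - h) = - arccos (sin h)" by (simp add: arc)
  ultimately have yr: "(y \<longlongrightarrow> - arccos (sin h)) at_top"
    unfolding filterlim_at_bot_mirror by simp
  show ?thesis
    unfolding Omega_saddles_connector_def
  proof (rule exI[of _ arctan], rule exI[of _ y], intro conjI allI)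
    show "(y has_real_derivative Omega_rhs a gam (sin h) l (arctan t) (y t)) (at t)" for t
      using y by (simp add: solves_def Omega_field_def)
  qed (use arctan_bounded yl yr arctan_has_derivative tendsto_arctan_at_bot tendsto_arctan_at_top in auto)
qed

section \<open>Shooting on a finite interval\<close>

text \<open>The family \<open>Y\<close> is picked pointwise by choice; the Gronwall estimate carries
  continuity in the parameters from time \<open>t0\<close> to every other time.\<close>

lemma param_continuous:
  fixes Y :: "real \<times> real \<Rightarrow> real \<Rightarrow> real"
  assumes sol: "\<And>p. p \<in> K \<Longrightarrow> solves (F p) (Y p)"
    and lip: "\<And>p t x y. p \<in> K \<Longrightarrow> \<bar>F p t x - F p t y\<bar> \<le> L * \<bar>x - y\<bar>"
    and par: "\<And>p q t x. \<bar>F p t x - F q t x\<bar> \<le> \<bar>snd p - snd q\<bar> + 2 * \<bar>fst p - fst q\<bar>"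
    and init: "continuous_on K (\<lambda>p. Y p t0)"
  shows "continuous_on K (\<lambda>p. Y p t)"
  unfolding continuous_on_def
proof
  fix p assume p: "p \<in> K"
  show "((\<lambda>p. Y p t) \<longlongrightarrow> Y p t) (at p within K)"
  proof (rule solves_tendsto[OF sol[OF p] _ lip[OF p]])
    show "\<forall>\<^sub>F q in at p within K. solves (F q) (Y q) \<and>
        (\<forall>t x. \<bar>F p t x - F q t x\<bar> \<le> \<bar>snd p - snd q\<bar> + 2 * \<bar>fst p - fst q\<bar>)"
      using sol par by (auto simp: eventually_at_filter)
    have "((\<lambda>q. \<bar>snd p - snd q\<bar> + 2 * \<bar>fst p - fst q\<bar>) \<longlongrightarrow>
        \<bar>snd p - snd p\<bar> + 2 * \<bar>fst p - fst p\<bar>) (at p within K)"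
      by (intro tendsto_intros)
    then show "((\<lambda>q. \<bar>snd p - snd q\<bar> + 2 * \<bar>fst p - fst q\<bar>) \<longlongrightarrow> 0) (at p within K)" by simp
    show "((\<lambda>p. Y p t0) \<longlongrightarrow> Y p t0) (at p within K)"
      using init p by (simp add: continuous_on_def)
  qed
qed

text \<open>The values prescribed at -N and N are mirror images under x -> -pi - x, so the trapping
  lemmas for the left end also apply to the reflected solutions.\<close>

lemma two_point_problem:
  assumes a: "0 < a" "a < 1 / 2" and gam: "\<bar>gam\<bar> \<le> 1 / 2"
    and e: "e = (1 - 2 * a) / 2" and h1: "1 \<le> h1" "h1 < pi / 2" and N: "0 \<le> N"
    and wind: "\<And>l y. -1 \<le> l \<Longrightarrow> l \<le> -1 + a \<Longrightarrow> solves (Omega_field a gam l h1) y \<Longrightarrow>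
      y (- N) = - pi / 2 - h1 * sin (arctan N) \<Longrightarrow> y N \<le> - pi"
  shows "\<exists>l h y z. l \<in> {-1..-1 + a} \<and> h \<in> {e..h1} \<and>
    solves (Theta_field a l h) y \<and> y (- N) = - theta (- N) \<and> y N = - theta N \<and>
    solves (Omega_field a gam l h) z \<and> z (- N) = - pi / 2 - h * sin (arctan N) \<and>
    z N = - pi / 2 + h * sin (arctan N)"
proof -
  let ?K = "{-1..-1 + a} \<times> {e..h1}" and ?s = "sin (arctan N)"
  have "\<exists>y. y (- N) = - theta (- N) \<and> solves (Theta_field a (fst p) (snd p)) y" if "p \<in> ?K" for p
    using that by (intro Theta_field_solution a) auto
  then obtain Y where Y: "\<And>p. p \<in> ?K \<Longrightarrow> Y p (- N) = - theta (- N)"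
    "\<And>p. p \<in> ?K \<Longrightarrow> solves (Theta_field a (fst p) (snd p)) (Y p)" by metis
  have "\<exists>z. z (- N) = - pi / 2 - snd p * ?s \<and> solves (Omega_field a gam (fst p) (snd p)) z" if "p \<in> ?K" for p
    using that by (intro Omega_field_solution a gam) auto
  then obtain Z where Z: "\<And>p. p \<in> ?K \<Longrightarrow> Z p (- N) = - pi / 2 - snd p * ?s"
    "\<And>p. p \<in> ?K \<Longrightarrow> solves (Omega_field a gam (fst p) (snd p)) (Z p)" by metis
  have E: "0 \<le> sin h" if "h \<in> {e..h1}" for h
    using that h1 e a by (intro sin_ge_zero) auto
  have e1: "e \<le> h1" using e a h1 by auto
  have s1: "0 \<le> ?s" using N cos_arctan_pos[of N] by (simp add: sin_arctan_eq)
  have "continuous_on ?K (\<lambda>p. Y p (- N))"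
    by (rule continuous_on_eq[OF continuous_on_const]) (use Y in auto)
  then have contY: "continuous_on ?K (\<lambda>p. Y p N)"
    by (rule param_continuous[where F = "\<lambda>p. Theta_field a (fst p) (snd p)", rotated 3])
      (rule Y(2) Theta_field_lipschitz[OF a] Theta_field_param[OF a]; force)+
  have "continuous_on ?K (\<lambda>p. - pi / 2 - snd p * ?s)" by (intro continuous_intros)
  then have "continuous_on ?K (\<lambda>p. Z p (- N))" by (rule continuous_on_eq) (use Z in auto)
  then have contZ: "continuous_on ?K (\<lambda>p. Z p N)"
    by (rule param_continuous[where F = "\<lambda>p. Omega_field a gam (fst p) (snd p)", rotated 3])
      (rule Z(2) Omega_field_lipschitz[OF a gam] Omega_field_param[OF a]; force)+
  \<comment> \<open>The radial mismatch is target minus end value, so that it is nonpositive at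
    \<open>h\<close> = \<open>e\<close> and nonnegative at \<open>h\<close> =
    \<open>h1\<close>.\<close>
  have "\<exists>p\<in>?K. Y p N + theta N = 0 \<and> - pi / 2 + snd p * ?s - Z p N = 0"
  proof (rule poincare_miranda)
    show "Y (-1, h) N + theta N \<le> 0" if "h \<in> {e..h1}" for h
      using Theta_le_minus_theta[OF a E[OF that], of "Y (-1, h)" N] Y[of "(-1, h)"] that N a by simp
    show "0 \<le> Y (-1 + a, h) N + theta N" if "h \<in> {e..h1}" for h
      using Theta_ge_minus_theta[OF a E[OF that], of "Y (-1 + a, h)" N] Y[of "(-1 + a, h)"] that N a by simp
    show "- pi / 2 + snd (l, e) * ?s - Z (l, e) N \<le> 0" if "l \<in> {-1..-1 + a}" for l
      using Omega_low_energy[OF a gam _ _ e, of l "Z (l, e)" N] Z[of "(l, e)"] that N e1 by simp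
    show "0 \<le> - pi / 2 + snd (l, h1) * ?s - Z (l, h1) N" if "l \<in> {-1..-1 + a}" for l
    proof -
      have "Z (l, h1) N \<le> - pi" using wind[of l "Z (l, h1)"] Z[of "(l, h1)"] that e1 by simp
      moreover have "0 \<le> h1 * ?s" using h1 s1 by simp
      ultimately show ?thesis using pi_gt_zero by (simp only: snd_conv)
    qed
  qed (use a e1 contY contZ in \<open>auto intro!: continuous_intros\<close>)
  then obtain p where p: "p \<in> ?K" "Y p N + theta N = 0" "- pi / 2 + snd p * ?s - Z p N = 0" by blast
  then show ?thesis using Y[OF p(1)] Z[OF p(1)]
    by (intro exI[of _ "fst p"] exI[of _ "snd p"] exI[of _ "Y p"] exI[of _ "Z p"]) auto
qed

section \<open>Passage to the whole line\<close>

theorem theorem9: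
  fixes a gam :: real
  assumes "0 < a" and "a < 1 / 2"
    and "- sqrt (2 * a * (1 - 2 * a)) < gam" and "gam < 0"
  shows "\<exists>lam E. lam \<in> {-1 - a .. -1 + a} \<and> E \<in> {0 <..< 1} \<and>
           Theta_saddles_connector a E lam \<and> Omega_saddles_connector a gam E lam"
proof -
  note a = assms(1,2)
  have gam: "- (1 / 2) \<le> gam" "\<bar>gam\<bar> \<le> 1 / 2" "\<bar>- gam\<bar> \<le> 1 / 2"
  proof -
    \<comment> \<open>This square gives 2a(1 - 2a) <= 1/4, hence the bound |gam| <= 1/2 of the
      radial estimates.\<close>
    have "0 \<le> (4 * a - 1)\<^sup>2" by simp
    then have "2 * a * (1 - 2 * a) \<le> (1 / 2)\<^sup>2" by (simp add: power2_eq_square algebra_simps)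
    then have "sqrt (2 * a * (1 - 2 * a)) \<le> 1 / 2" by (intro real_le_lsqrt) auto
    then show "- (1 / 2) \<le> gam" "\<bar>gam\<bar> \<le> 1 / 2" "\<bar>- gam\<bar> \<le> 1 / 2" using assms by auto
  qed
  obtain h1 W where h1: "1 \<le> h1" "h1 < pi / 2" and wind:
    "\<And>l y N. -1 \<le> l \<Longrightarrow> l \<le> -1 + a \<Longrightarrow> W \<le> N \<Longrightarrow> solves (Omega_field a gam l h1) y \<Longrightarrow>
      y (- N) = - pi / 2 - h1 * sin (arctan N) \<Longrightarrow> y N \<le> - pi"
    using Omega_winds_down[OF a gam(1) assms(4)] by metis
  define e where "e = (1 - 2 * a) / 2"
  have e: "0 < e" "e < 1" using a by (auto simp: e_def)
  \<comment> \<open>Half of the gap between \<open>h1\<close> and pi/2 is left as room for the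
    barriers. \<open>A\<close> is the amplitude required by \<open>Omega_trap\<close> and
    \<open>T\<close> the time beyond which the barriers stay within \<open>d\<close>; all three are
    independent of the interval.\<close>
  define d where "d = (pi / 2 - h1) / 2"
  have d: "0 < d" "h1 + d < pi / 2" using h1 by (auto simp: d_def field_simps)
  define A where "A = 3 / (a * cos (h1 + d))"
  have k: "0 < cos (h1 + d)" using h1 d by (intro cos_gt_zero_pi) auto
  have A: "0 < A" "A * a * cos (h1 + d) = 3" using k a by (auto simp: A_def)
  define T where "T = A / d"
  have T0: "0 < T" using A d by (simp add: T_def)
  have T: "A * cos (arctan t) \<le> d" if "t \<le> - T" for t
  proof -
    have "cos (arctan t) \<le> d / A"
      using that A d T0 by (intro cos_arctan_small) (auto simp: T_def)
    then show ?thesis using A by (simp add: field_simps)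
  qed
  \<comment> \<open>Large enough for the winding estimate and for -T to lie in the interval, and
    unbounded in \<open>n\<close>.\<close>
  define N where "N n = max W T + real n" for n :: nat
  have N: "W \<le> N n" "T \<le> N n" "0 \<le> N n" "real n \<le> N n" for n
    using T0 by (auto simp: N_def)
  have "\<forall>n. \<exists>l h y z. l \<in> {-1..-1 + a} \<and> h \<in> {e..h1} \<and>
    solves (Theta_field a l h) y \<and> y (- N n) = - theta (- N n) \<and> y (N n) = - theta (N n) \<and>
    solves (Omega_field a gam l h) z \<and> z (- N n) = - pi / 2 - h * sin (arctan (N n)) \<and>
    z (N n) = - pi / 2 + h * sin (arctan (N n))"
    by (intro allI two_point_problem[OF a gam(2) e_def h1 N(3)]) (rule wind[OF _ _ N(1)])
  then obtain l h y z where S: "\<forall>n. l n \<in> {-1..-1 + a} \<and> h n \<in> {e..h1} \<and>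
    solves (Theta_field a (l n) (h n)) (y n) \<and> y n (- N n) = - theta (- N n) \<and> y n (N n) = - theta (N n) \<and>
    solves (Omega_field a gam (l n) (h n)) (z n) \<and> z n (- N n) = - pi / 2 - h n * sin (arctan (N n)) \<and>
    z n (N n) = - pi / 2 + h n * sin (arctan (N n))"
    unfolding choice_iff by (elim exE) (rule that)
  then have lh: "\<And>n. -1 \<le> l n" "\<And>n. l n \<le> -1 + a" "\<And>n. e \<le> h n" "\<And>n. h n \<le> h1"
    unfolding atLeastAtMost_iff by blast+
  have y: "\<And>n. solves (Theta_field a (l n) (h n)) (y n)"
      "\<And>n. y n (- N n) = - theta (- N n)" "\<And>n. y n (N n) = - theta (N n)"
    and z: "\<And>n. solves (Omega_field a gam (l n) (h n)) (z n)"
      "\<And>n. z n (- N n) = - pi / 2 - h n * sin (arctan (N n))"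
      "\<And>n. z n (N n) = - pi / 2 + h n * sin (arctan (N n))"
    using S by blast+
  have h0: "0 \<le> h n" for n using lh(3)[of n] e by linarith
  have E: "0 \<le> sin (h n)" for n
    using h0[of n] lh(4)[of n] h1 by (intro sin_ge_zero) auto
  have ytrap: "- (3 * theta t) \<le> y n t" "y n t \<le> 0" if "\<bar>t\<bar> \<le> N n" for n t
    using Theta_trap[OF a lh(1,2) E y, of n t] that by auto
  have ytrap': "- (3 * theta t) \<le> - pi - y n (- t)" "- pi - y n (- t) \<le> 0" if "\<bar>t\<bar> \<le> N n" for n t
  proof -
    have "solves (Theta_field a (l n) (h n)) (\<lambda>t. - pi - y n (- t))"
      using solves_reflect[OF y(1)[of n], of "- pi"] by (simp add: Theta_field_reflect)
    from Theta_trap[OF a lh(1,2) E this, of "N n" t]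
    show "- (3 * theta t) \<le> - pi - y n (- t)" "- pi - y n (- t) \<le> 0"
      using that y(2,3)[of n] by (auto simp: theta_minus)
  qed
  have ztrap: "\<bar>z n t - (- pi / 2 - h n)\<bar> \<le> A * cos (arctan t)" if "- N n \<le> t" "t \<le> - T" for n t
    using Omega_trap[OF a gam(2) lh(1,2) h0 lh(4) less_imp_le[OF d(1)] d(2) A(2) T _ z(1,2) that] T0 by simp
  have ztrap': "\<bar>- pi - z n (- t) - (- pi / 2 - h n)\<bar> \<le> A * cos (arctan t)" if "- N n \<le> t" "t \<le> - T" for n t
  proof -
    have 1: "solves (Omega_field a (- gam) (l n) (h n)) (\<lambda>t. - pi - z n (- t))"
      using solves_reflect[OF z(1)[of n], of "- pi"] by (simp add: Omega_field_reflect)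
    have 2: "- pi - z n (- (- N n)) = - pi / 2 - h n * sin (arctan (N n))" by (simp add: z(3))
    show ?thesis
      using Omega_trap[OF a gam(3) lh(1,2) h0 lh(4) less_imp_le[OF d(1)] d(2) A(2) T _ 1 2 that] T0 by simp
  qed
  \<comment> \<open>Only four numbers need a convergent subsequence: the two parameters and the two
    values at the fixed time -T, which the traps confine to a box independent of
    \<open>n\<close>.\<close>
  let ?C = "({-1..-1 + a} \<times> {e..h1}) \<times> ({- 3 * pi..0} \<times> {- pi - d..d})"
  have "seq_compact ?C"
    by (intro compact_imp_seq_compact compact_Times compact_Icc)
  moreover have "\<forall>n. ((l n, h n), (y n (- T), z n (- T))) \<in> ?C"
  proof
    fix n
    have "- 3 * pi \<le> y n (- T)" "y n (- T) \<le> 0"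
      using ytrap[of "- T" n] theta_bounds[of "- T"] N(2)[of n] T0 by auto
    moreover have "\<bar>z n (- T) - (- pi / 2 - h n)\<bar> \<le> d"
      using ztrap[of n "- T"] T[of "- T"] N(2)[of n] by auto
    ultimately show "((l n, h n), (y n (- T), z n (- T))) \<in> ?C"
      using lh[of n] h0[of n] h1 by auto
  qed
  ultimately obtain q r where q: "q \<in> ?C" and r: "strict_mono r" and
    lim: "((\<lambda>n. ((l n, h n), (y n (- T), z n (- T)))) \<circ> r) \<longlonglongrightarrow> q"
    by (rule seq_compactE)
  obtain l' h' y0 z0 where q': "q = ((l', h'), (y0, z0))" by (metis prod.collapse)
  have lh': "-1 \<le> l'" "l' \<le> -1 + a" "e \<le> h'" "h' \<le> h1" using q q' by auto
  have lims: "(\<lambda>i. l (r i)) \<longlonglongrightarrow> l'" "(\<lambda>i. h (r i)) \<longlonglongrightarrow> h'"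
    "(\<lambda>i. y (r i) (- T)) \<longlonglongrightarrow> y0" "(\<lambda>i. z (r i) (- T)) \<longlonglongrightarrow> z0"
    using tendsto_fst[OF tendsto_fst[OF lim]] tendsto_snd[OF tendsto_fst[OF lim]]
      tendsto_fst[OF tendsto_snd[OF lim]] tendsto_snd[OF tendsto_snd[OF lim]]
    by (simp_all add: q' o_def)
  let ?err = "\<lambda>i. \<bar>h' - h (r i)\<bar> + 2 * \<bar>l' - l (r i)\<bar>"
  have "?err \<longlonglongrightarrow> \<bar>h' - h'\<bar> + 2 * \<bar>l' - l'\<bar>" by (intro tendsto_intros lims)
  then have err: "?err \<longlonglongrightarrow> 0" by simp
  \<comment> \<open>The solutions through the limiting data at -T are the candidates; continuous
    dependence gives convergence at every t, and the trapping bounds pass to the limit.\<close>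
  obtain y' where y': "y' (- T) = y0" "solves (Theta_field a l' h') y'"
    using Theta_field_solution[OF a lh'(1,2)] by blast
  obtain z' where z': "z' (- T) = z0" "solves (Omega_field a gam l' h') z'"
    using Omega_field_solution[OF a gam(2) lh'(1,2)] by blast
  have ylim: "(\<lambda>i. y (r i) t) \<longlonglongrightarrow> y' t" for t
    by (rule solves_tendsto[OF y'(2) _ Theta_field_lipschitz[OF a lh'(1,2)] err, where y = "\<lambda>i. y (r i)" and ?t0.0 = "- T"
          and f = "\<lambda>i. Theta_field a (l (r i)) (h (r i))"])
      (use y y' lims Theta_field_param[OF a] in auto)
  have zlim: "(\<lambda>i. z (r i) t) \<longlonglongrightarrow> z' t" for t
    by (rule solves_tendsto[OF z'(2) _ Omega_field_lipschitz[OF a gam(2) lh'(1,2)] err, where y = "\<lambda>i. z (r i)" and ?t0.0 = "- T"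
          and f = "\<lambda>i. Omega_field a gam (l (r i)) (h (r i))"])
      (use z z' lims Omega_field_param[OF a] in auto)
  have big: "\<exists>k. \<forall>i\<ge>k. \<bar>t\<bar> \<le> N (r i)" for t
  proof (intro exI allI impI)
    fix i assume "nat \<lceil>\<bar>t\<bar>\<rceil> \<le> i"
    then have "\<bar>t\<bar> \<le> real i" by linarith
    also have "\<dots> \<le> real (r i)" using seq_suble[OF r] by simp
    also have "\<dots> \<le> N (r i)" by (rule N)
    finally show "\<bar>t\<bar> \<le> N (r i)" .
  qed
  have "Theta_saddles_connector a (sin h') l'"
  proof (rule Theta_connectorI[OF y'(2)])
    fix t
    obtain k where k: "\<forall>i\<ge>k. \<bar>t\<bar> \<le> N (r i)" using big by blast
    show "- (3 * theta t) \<le> y' t"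
      by (rule LIMSEQ_le_const[OF ylim]) (use k ytrap in blast)
    show "y' t \<le> 0"
      by (rule LIMSEQ_le_const2[OF ylim]) (use k ytrap in blast)
    have "- pi \<le> y (r i) t \<and> y (r i) t \<le> - pi + 3 * theta (- t)" if "k \<le> i" for i
      using ytrap'[of "- t" "r i"] k that by auto
    then show "- pi \<le> y' t" "y' t \<le> - pi + 3 * theta (- t)"
      using LIMSEQ_le_const[OF ylim] LIMSEQ_le_const2[OF ylim] by blast+
  qed
  moreover have "Omega_saddles_connector a gam (sin h') l'"
  proof (rule Omega_connectorI[OF z'(2), of T A])
    fix t assume t: "t \<le> - T"
    obtain k where k: "\<forall>i\<ge>k. \<bar>t\<bar> \<le> N (r i)" using big by blast
    have k': "- N (r i) \<le> t" if "k \<le> i" for i using k that by fastforce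
    have "(\<lambda>i. \<bar>z (r i) t - (- pi / 2 - h (r i))\<bar>) \<longlonglongrightarrow> \<bar>z' t - (- pi / 2 - h')\<bar>"
      by (intro tendsto_intros zlim lims)
    then show "\<bar>z' t - (- pi / 2 - h')\<bar> \<le> A * cos (arctan t)"
      by (rule LIMSEQ_le_const2) (use k' ztrap t in blast)
    have "(\<lambda>i. \<bar>- pi - z (r i) (- t) - (- pi / 2 - h (r i))\<bar>) \<longlonglongrightarrow> \<bar>- pi - z' (- t) - (- pi / 2 - h')\<bar>"
      by (intro tendsto_intros zlim lims)
    then show "\<bar>- pi - z' (- t) - (- pi / 2 - h')\<bar> \<le> A * cos (arctan t)"
      by (rule LIMSEQ_le_const2) (use k' ztrap' t in blast)
  qed (use lh' e h1 in auto)
  \<comment> \<open>Strictness survives the limit because [e, h1] is a compact subset of (0,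
    pi/2).\<close>
  moreover have "0 < sin h'" "sin h' < 1"
  proof -
    show "0 < sin h'" using lh' e h1 by (intro sin_gt_zero) auto
    have "sin h' < sin (pi / 2)" using lh' e h1 by (intro sin_monotone_2pi) auto
    then show "sin h' < 1" by simp
  qed
  ultimately show ?thesis using lh'(1,2) a
    by (intro exI[of _ l'] exI[of _ "sin h'"]) auto
qed

end
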